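(* Let $K\ge 2$ and $L\ge 1$ be integers and let $(\mathcal X,H,Q)$ be the energy landscape corresponding to the hard-core dynamics on the $2K\times 3L$ triangular grid $\Lambda$ with periodic boundary conditions. Then: (i) $\mathcal X^s=\{\mathbf a,\mathbf b,\mathbf c\}$; (ii) $\Phi(\mathbf a,\mathbf b)-H(\mathbf a)=\Phi(\mathbf a,\mathbf c)-H(\mathbf a)=\Phi(\mathbf b,\mathbf c)-H(\mathbf b)=\min\{K,2L\}+1$; (iii) $\Phi(\sigma,\{\mathbf a,\mathbf b,\mathbf c\})-H(\sigma)\le\min\{K,2L\}$ for all $\sigma\in\mathcal X\setminus\{\mathbf a,\mathbf b,\mathbf c\}$.
   Context: Triangular grid. For integers $K\ge2$, $L\ge1$, the $2K\times 3L$ triangular grid $\Lambda=(V,E)$ with periodic boundary conditions has vertex set (sites) $V=\{(x,y)\in \mathbb Z/6L\mathbb Z\times\mathbb Z/2K\mathbb Z : x\equiv y \pmod 2\}$ (so there are $2K$ rows, indexed by $y$, of $3L$ sites each, and $6L$ columns, indexed by $x$, of $K$ sites each), and the six neighbors of $(x,y)$ are $(x\pm2,y)$ and $(x\pm1,y\pm1)$ (all four sign choices). Let $N=|V|=6KL$. The sets $V_{\mathbf a},V_{\mathbf b},V_{\mathbf c}$ consist of the sites $(x,y)$ with $x\equiv 0,1,2\pmod 3$, respectively; they form a tripartition of $\Lambda$, each of size $2KL$. Energy landscape. $\mathcal X$ is the set of hard-core configurations, i.e. maps $\sigma:V\to\{0,1\}$ with $\sigma(v)\sigma(w)=0$ for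 every pair of neighboring sites $v,w$. The configurations $\mathbf a,\mathbf b,\mathbf c\in\mathcal X$ are the indicator functions of $V_{\mathbf a},V_{\mathbf b},V_{\mathbf c}$. The Hamiltonian is $H(\sigma)=-\sum_{v\in V}\sigma(v)$. For $\sigma\ne\sigma'$ in $\mathcal X$, $Q(\sigma,\sigma')=1/N$ if $\sigma,\sigma'$ differ at exactly one site and $Q(\sigma,\sigma')=0$ otherwise. $\mathcal X^s$ denotes the set of stable configurations, i.e. the global minima of $H$ on $\mathcal X$. Communication height. A path $\omega:\sigma\to\sigma'$ is a finite sequence $\omega_1,\dots,\omega_n\in\mathcal X$ with $\omega_1=\sigma$, $\omega_n=\sigma'$ and $Q(\omega_i,\omega_{i+1})>0$ for $i=1,\dots,n-1$. Its height is $\Phi_\omega=\max_{i}H(\omega_i)$. The communication height is $\Phi(\sigma,\sigma')=\min_{\omega:\sigma\to\sigma'}\Phi_\omega$, and for disjoint nonempty $A,B\subset\mathcal X$, $\Phi(A,B)=\min_{\sigma\in A,\sigma'\in B}\Phi(\sigma,\sigma')$; $\Phi(\sigma,B)$ means $\Phi(\{\sigma\},B)$. *)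

theory Defs
  imports Complex_Main "HOL-Library.FuncSet"
begin

definition stable_configs :: "'s set \<Rightarrow> ('s \<Rightarrow> int) \<Rightarrow> 's set" where
  "stable_configs X H = {\<sigma> \<in> X. \<forall>\<tau>\<in>X. H \<sigma> \<le> H \<tau>}"

definition is_path :: "'s set \<Rightarrow> ('s \<Rightarrow> 's \<Rightarrow> real) \<Rightarrow> 's \<Rightarrow> 's list \<Rightarrow> 's \<Rightarrow> bool" where
  "is_path X Q \<sigma> \<omega> \<sigma>' \<longleftrightarrow>
     \<omega> \<noteq> [] \<and> set \<omega> \<subseteq> X \<and> hd \<omega> = \<sigma> \<and> last \<omega> = \<sigma>' \<and>
     (\<forall>i. Suc i < length \<omega> \<longrightarrow> Q (\<omega> ! i) (\<omega> ! Suc i) > 0)"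

definition path_height :: "('s \<Rightarrow> int) \<Rightarrow> 's list \<Rightarrow> int" where
  "path_height H \<omega> = Max (H ` set \<omega>)"

text \<open>
  There are infinitely many paths between two configurations, but for a finite \<open>X\<close> their heights
  lie in the finite set \<open>H ` X\<close>, so the minimum exists as soon as some path exists.
\<close>

definition comm_height ::
    "'s set \<Rightarrow> ('s \<Rightarrow> int) \<Rightarrow> ('s \<Rightarrow> 's \<Rightarrow> real) \<Rightarrow> 's \<Rightarrow> 's \<Rightarrow> int" where
  "comm_height X H Q \<sigma> \<sigma>' = Min {path_height H \<omega> |\<omega>. is_path X Q \<sigma> \<omega> \<sigma>'}"

definition comm_height_sets ::
    "'s set \<Rightarrow> ('s \<Rightarrow> int) \<Rightarrow> ('s \<Rightarrow> 's \<Rightarrow> real) \<Rightarrow> 's set \<Rightarrow> 's set \<Rightarrow> int" where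
  "comm_height_sets X H Q A B = Min {comm_height X H Q \<sigma> \<sigma>' |\<sigma> \<sigma>'. \<sigma> \<in> A \<and> \<sigma>' \<in> B}"

text \<open>
  Elements of \<open>\<int>/6L\<int> \<times> \<int>/2K\<int>\<close> are represented by their canonical representatives in
  \<open>{0..<6L} \<times> {0..<2K}\<close>; since \<open>6L\<close> and \<open>2K\<close> are even and \<open>3\<close> divides \<open>6L\<close>, the parities of both
  coordinates and the class of \<open>x\<close> modulo \<open>3\<close> can be read off from them.
\<close>

type_synonym site = "int \<times> int"
type_synonym config = "site \<Rightarrow> int"

definition sites :: "nat \<Rightarrow> nat \<Rightarrow> site set" where
  "sites K L = {(x, y). 0 \<le> x \<and> x < 6 * int L \<and> 0 \<le> y \<and> y < 2 * int K \<and> x mod 2 = y mod 2}"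

definition neighbors :: "nat \<Rightarrow> nat \<Rightarrow> site \<Rightarrow> site set" where
  "neighbors K L = (\<lambda>(x, y).
     {((x + dx) mod (6 * int L), (y + dy) mod (2 * int K)) |dx dy.
       (dx, dy) \<in> {(2, 0), (-2, 0), (1, 1), (1, -1), (-1, 1), (-1, -1)}})"

definition sites_class :: "nat \<Rightarrow> nat \<Rightarrow> int \<Rightarrow> site set" where
  "sites_class K L r = {(x, y) \<in> sites K L. x mod 3 = r}"

text \<open>Extensional function spaces are used so that maps on \<open>V\<close> are equal iff they agree on \<open>V\<close>.\<close>

definition hc_configs :: "nat \<Rightarrow> nat \<Rightarrow> config set" where
  "hc_configs K L =
     {\<sigma> \<in> sites K L \<rightarrow>\<^sub>E {0, 1}. \<forall>v\<in>sites K L. \<forall>w\<in>neighbors K L v. \<sigma> v * \<sigma> w = 0}"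

definition conf_of :: "nat \<Rightarrow> nat \<Rightarrow> site set \<Rightarrow> config" where
  "conf_of K L S = (\<lambda>v\<in>sites K L. if v \<in> S then 1 else 0)"

definition conf_a :: "nat \<Rightarrow> nat \<Rightarrow> config" where
  "conf_a K L = conf_of K L (sites_class K L 0)"

definition conf_b :: "nat \<Rightarrow> nat \<Rightarrow> config" where
  "conf_b K L = conf_of K L (sites_class K L 1)"

definition conf_c :: "nat \<Rightarrow> nat \<Rightarrow> config" where
  "conf_c K L = conf_of K L (sites_class K L 2)"

definition hamiltonian :: "nat \<Rightarrow> nat \<Rightarrow> config \<Rightarrow> int" where
  "hamiltonian K L \<sigma> = - (\<Sum>v\<in>sites K L. \<sigma> v)"

definition differ_at_one :: "nat \<Rightarrow> nat \<Rightarrow> config \<Rightarrow> config \<Rightarrow> bool" where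
  "differ_at_one K L \<sigma> \<sigma>' \<longleftrightarrow> card {v \<in> sites K L. \<sigma> v \<noteq> \<sigma>' v} = 1"

text \<open>
  The diagonal entries are the ones making \<open>Q\<close> a stochastic matrix. They only decide whether a path
  may repeat a configuration in consecutive positions, which does not affect any height.
\<close>

definition hc_Q :: "nat \<Rightarrow> nat \<Rightarrow> config \<Rightarrow> config \<Rightarrow> real" where
  "hc_Q K L \<sigma> \<sigma>' =
     (if \<sigma> = \<sigma>'
      then 1 - real (card {\<eta> \<in> hc_configs K L. differ_at_one K L \<sigma> \<eta>}) / real (card (sites K L))
      else if differ_at_one K L \<sigma> \<sigma>' then 1 / real (card (sites K L)) else 0)"

abbreviation Phi :: "nat \<Rightarrow> nat \<Rightarrow> config \<Rightarrow> config \<Rightarrow> int" where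
  "Phi K L \<equiv> comm_height (hc_configs K L) (hamiltonian K L) (hc_Q K L)"

abbreviation Phi_sets :: "nat \<Rightarrow> nat \<Rightarrow> config set \<Rightarrow> config set \<Rightarrow> int" where
  "Phi_sets K L \<equiv> comm_height_sets (hc_configs K L) (hamiltonian K L) (hc_Q K L)"

end

theory Submission
  imports Defs
begin

text \<open>
  A configuration is identified with its set of occupied sites, an independent set of the torus.
  Write \<open>m = min {K, 2L}\<close>; the \<^emph>\<open>classes\<close> are the three sets of sites with \<open>x mod 3 = r\<close>, and the
  \<^emph>\<open>deficit\<close> of an independent set is the number of particles it lacks to reach \<open>2KL\<close>.

  \<^emph>\<open>Ground states.\<close> Two adjacent rows form a closed zigzag of \<open>6L\<close> sites in which any three
  consecutive sites are pairwise adjacent. So they carry at most \<open>2L\<close> particles, and exactly \<open>2L\<close>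
  only if the particles fill one class in these rows (\<open>pair_of_rows_le\<close>). Summing over \<open>K\<close> disjoint
  pairs bounds every independent set by \<open>2KL\<close>, and in case of equality the classes found in
  overlapping pairs must agree. In the same way three adjacent columns carry at most \<open>K\<close> particles, but
  here equality only forces the middle column to be full or empty (\<open>window_le\<close>).

  \<^emph>\<open>Low paths.\<close> If the sites of a class can be listed so that each of them has, when its turn
  comes, at most one occupied neighbour, then the class can be filled by swaps, and no more than one
  particle is ever missing compared with the start (\<open>fill\<close>). Such a list exists row by row, once the
  other classes have been removed from two adjacent rows (\<open>horizontal_sweep\<close>), and column by column,
  once two adjacent columns have been emptied, except that a full column in the way costs one more
  particle (\<open>vertical_sweep\<close>). The preparation costs at most \<open>2L\<close>, respectively \<open>K\<close>, particles, which
  gives barriers \<open>m + 1\<close> between classes. One particle is saved if the target class may be chosen: a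
  pair of rows that costs \<open>2L\<close> is full of one class, and that class is then a target that costs
  nothing. For columns, either some two adjacent columns cost less than \<open>K\<close>, or there is a full
  column, whose class is a target with barrier at most \<open>2 \<le> K\<close>.

  \<^emph>\<open>Lower bound.\<close> A set of deficit less than \<open>m\<close> has a pair of adjacent rows filled by some
  class, and this class is unique: there are also three adjacent columns with \<open>K\<close> particles and
  with middle column in that class; they cross the two rows, which forces the middle column to be full,
  and a full column meets every other pair of rows (\<open>strip_unique\<close>). Adding or removing one particle
  between two such sets cannot change the class. What remains is a visit to deficit exactly \<open>m\<close>, where
  a particle is removed and another one is added. There the same crossing argument still works, because
  a change of class would force every pair of adjacent rows to have deficit exactly one
  (\<open>bottleneck_strips_agree\<close>). So a path that never exceeds deficit \<open>m\<close> never leaves its class.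
\<close>

section \<open>Sums and residues of periodic integer functions\<close>

lemma sum_periodic_shift:
  fixes p :: "int \<Rightarrow> int"
  assumes "\<And>x. p (x + int n) = p x"
  shows "(\<Sum>i<n. p (s + int i)) = (\<Sum>i<n. p (int i))"
proof -
  have step: "(\<Sum>i<n. p (t + 1 + int i)) = (\<Sum>i<n. p (t + int i))" for t
  proof -
    have "(\<Sum>i<n. p (t + 1 + int i)) + p t = (\<Sum>i<Suc n. p (t + int i))"
      unfolding sum.lessThan_Suc_shift by (simp add: algebra_simps)
    then show ?thesis using assms[of t] by simp
  qed
  show ?thesis
  proof (induction s rule: int_induct[where k = 0])
    case base
    then show ?case by simp
  next
    case (step1 i)
    then show ?case using step[of i] by simp
  next
    case (step2 i)
    then show ?case using step[of "i - 1"] by simp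
  qed
qed

lemma sum_periodic_blocks:
  fixes p :: "int \<Rightarrow> int"
  assumes "\<And>x. p (x + int (n * k)) = p x"
  shows "(\<Sum>i<n * k. p (int i)) = (\<Sum>j<n. \<Sum>i<k. p (s + int k * int j + int i))"
proof -
  have "(\<Sum>i<n * k. p (int i)) = (\<Sum>i<n * k. p (s + int i))"
    using sum_periodic_shift[of p "n * k" s] assms by simp
  also have "\<dots> = (\<Sum>j<n. \<Sum>i\<in>{j * k..<j * k + k}. p (s + int i))"
    by (rule sum.nat_group[symmetric])
  also have "\<dots> = (\<Sum>j<n. \<Sum>i<k. p (s + int k * int j + int i))"
  proof (rule sum.cong[OF refl])
    fix j
    have "(\<Sum>i\<in>{j * k..<j * k + k}. p (s + int i)) = (\<Sum>i\<in>{0..<k}. p (s + int (i + j * k)))"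
      using sum.shift_bounds_nat_ivl[of "\<lambda>i. p (s + int i)" 0 "j * k" k] by (simp add: add.commute)
    then show "(\<Sum>i\<in>{j * k..<j * k + k}. p (s + int i)) = (\<Sum>i<k. p (s + int k * int j + int i))"
      by (simp add: atLeast0LessThan algebra_simps)
  qed
  finally show ?thesis .
qed

lemma periodic_mult:
  fixes p :: "int \<Rightarrow> 'a"
  assumes "\<And>x. p (x + d) = p x"
  shows "p (x + d * k) = p x"
proof (induction k rule: int_induct[where k = 0])
  case (step1 i)
  then show ?case using assms[of "x + d * i"] by (simp add: algebra_simps)
next
  case (step2 i)
  then show ?case using assms[of "x + d * (i - 1)"] by (simp add: algebra_simps)
qed simp

lemma sum_all_eq:
  fixes p :: "'a \<Rightarrow> int"
  assumes "finite A" "\<And>x. x \<in> A \<Longrightarrow> p x \<le> c" "sum p A \<ge> c * int (card A)" "a \<in> A"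
  shows "p a = c"
proof (rule ccontr)
  assume "p a \<noteq> c"
  then have "sum p A < (\<Sum>x\<in>A. c)"
    using assms by (intro sum_strict_mono_ex1) (auto intro!: bexI[of _ a] simp: order.strict_iff_order)
  with assms show False by (simp add: mult.commute)
qed

lemma sum_only_first:
  fixes p :: "nat \<Rightarrow> int"
  assumes "0 < n" "\<And>j. 0 < j \<Longrightarrow> j < n \<Longrightarrow> p j = 0"
  shows "(\<Sum>j<n. p j) = p 0"
proof -
  obtain m where "n = Suc m" using assms(1) by (cases n) auto
  then show ?thesis using assms(2) by (simp add: sum.lessThan_Suc_shift del: sum.lessThan_Suc)
qed

lemma mod_neq_of_lt:
  fixes a b m :: int
  assumes "0 < a - b" "a - b < m"
  shows "a mod m \<noteq> b mod m"
  using assms zdvd_not_zless by (metis mod_eq_dvd_iff)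

section \<open>Points of the torus and hard-core sets\<close>

locale torus =
  fixes K L :: nat
  assumes K2: "K \<ge> 2" and L1: "L \<ge> 1"
begin

abbreviation V :: "site set" where "V \<equiv> sites K L"
abbreviation N :: "site \<Rightarrow> site set" where "N \<equiv> neighbors K L"
abbreviation cls :: "int \<Rightarrow> site set" where "cls \<equiv> sites_class K L"

text \<open>
  Coordinates range over all integers and are wrapped around the torus by \<open>pt\<close>.
  Neighbours are then plain integer translations, and no arithmetic on representatives is needed.
\<close>

definition pt :: "int \<Rightarrow> int \<Rightarrow> site" where
  "pt x y = (x mod (6 * int L), y mod (2 * int K))"

lemma pt_eq_iff:
  "pt x y = pt x' y' \<longleftrightarrow> x mod (6 * int L) = x' mod (6 * int L) \<and> y mod (2 * int K) = y' mod (2 * int K)"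
  by (simp add: pt_def)

lemma pt_periodic [simp]: "pt (x + 6 * int L) y = pt x y" "pt x (y + 2 * int K) = pt x y"
  by (simp_all add: pt_def)

lemma pt_in_V [simp]: "pt x y \<in> V \<longleftrightarrow> even (x + y)"
proof -
  have "(x mod (6 * int L)) mod 2 = x mod 2" "(y mod (2 * int K)) mod 2 = y mod 2"
    by (simp_all add: mod_mod_cancel)
  moreover have "x mod 2 = y mod 2 \<longleftrightarrow> even (x + y)" by presburger
  ultimately show ?thesis using K2 L1 by (simp add: pt_def sites_def)
qed

lemma mod_6L_mod_3: "(x mod (6 * int L)) mod 3 = x mod 3"
  by (simp add: mod_mod_cancel)

lemma pt_in_cls [simp]: "pt x y \<in> cls r \<longleftrightarrow> even (x + y) \<and> x mod 3 = r"
  using pt_in_V[of x y] by (auto simp: sites_class_def pt_def mod_6L_mod_3)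

lemma V_pt_E:
  assumes "v \<in> V"
  obtains x y where "v = pt x y" "even (x + y)" "0 \<le> x" "x < 6 * int L" "0 \<le> y" "y < 2 * int K"
proof -
  obtain x y where v: "v = (x, y)" by (cases v)
  with assms have *: "0 \<le> x" "x < 6 * int L" "0 \<le> y" "y < 2 * int K" by (auto simp: sites_def)
  then have "v = pt x y" by (simp add: v pt_def)
  with * assms that show thesis by auto
qed

lemma cls_subset_V: "cls r \<subseteq> V"
  by (auto simp: sites_class_def)

lemma finite_V [simp]: "finite V"
  by (rule finite_subset[of _ "{0..<6 * int L} \<times> {0..<2 * int K}"]) (auto simp: sites_def)

lemma neighbors_pt:
  "N (pt x y) = {pt (x + 2) y, pt (x - 2) y, pt (x + 1) (y + 1), pt (x + 1) (y - 1),
                 pt (x - 1) (y + 1), pt (x - 1) (y - 1)}"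
proof -
  have shift: "((x mod (6 * int L) + dx) mod (6 * int L), (y mod (2 * int K) + dy) mod (2 * int K))
      = pt (x + dx) (y + dy)" for dx dy
    by (simp add: pt_def mod_simps)
  have setc: "{pt (x + dx) (y + dy) |dx dy. (dx, dy) \<in> D} = (\<lambda>(dx, dy). pt (x + dx) (y + dy)) ` D" for D
    by force
  have "N (pt x y) = (\<lambda>(dx, dy). pt (x + dx) (y + dy)) `
      {(2, 0), (-2, 0), (1, 1), (1, -1), (-1, 1), (-1, -1)}"
    unfolding neighbors_def pt_def[of x y] prod.case shift setc ..
  then show ?thesis by simp
qed

lemma pt_neq:
  "pt (x + 2) y \<noteq> pt x y" "pt (x + 1) (y + 1) \<noteq> pt x y" "pt (x + 1) (y - 1) \<noteq> pt x y"
proof -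
  have "(x + d) mod (6 * int L) \<noteq> x mod (6 * int L)" if "d \<in> {1, 2}" for d
  proof
    assume "(x + d) mod (6 * int L) = x mod (6 * int L)"
    then have "6 * int L dvd x + d - x" by (simp only: mod_eq_dvd_iff)
    then have "6 * int L dvd d" by simp
    then show False using zdvd_imp_le[of "6 * int L" d] that L1 by auto
  qed
  then show "pt (x + 2) y \<noteq> pt x y" "pt (x + 1) (y + 1) \<noteq> pt x y" "pt (x + 1) (y - 1) \<noteq> pt x y"
    by (auto simp: pt_eq_iff)
qed

lemma neighbors_sym: "v \<in> V \<Longrightarrow> u \<in> N v \<Longrightarrow> v \<in> N u"
  by (elim V_pt_E) (auto simp: neighbors_pt)

lemma neighbors_irrefl:
  assumes "v \<in> V"
  shows "v \<notin> N v"
proof -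
  obtain x y where v: "v = pt x y" using V_pt_E[OF assms] by blast
  show ?thesis
    using pt_neq[of x y] pt_neq(1)[of "x - 2" y] pt_neq(2)[of "x - 1" "y - 1"]
      pt_neq(3)[of "x - 1" "y + 1"]
    by (auto simp: v neighbors_pt)
qed

lemma neighbors_in_V: "v \<in> V \<Longrightarrow> N v \<subseteq> V"
  by (elim V_pt_E) (auto simp: neighbors_pt)

definition indep :: "site set \<Rightarrow> bool" where
  "indep S \<longleftrightarrow> S \<subseteq> V \<and> (\<forall>v\<in>S. N v \<inter> S = {})"

lemma indep_finite: "indep S \<Longrightarrow> finite S"
  unfolding indep_def by (meson finite_V finite_subset)

lemma indep_subset: "indep S \<Longrightarrow> A \<subseteq> S \<Longrightarrow> indep A"
  unfolding indep_def by blast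

lemma indep_pt_even: "indep S \<Longrightarrow> pt x y \<in> S \<Longrightarrow> even (x + y)"
  unfolding indep_def by (metis pt_in_V subsetD)

lemma indep_pt:
  assumes "indep S" "pt x y \<in> S"
  shows "pt (x + 2) y \<notin> S" "pt (x - 2) y \<notin> S" "pt (x + 1) (y + 1) \<notin> S"
    "pt (x + 1) (y - 1) \<notin> S" "pt (x - 1) (y + 1) \<notin> S" "pt (x - 1) (y - 1) \<notin> S"
proof -
  have "N (pt x y) \<inter> S = {}" using assms by (simp add: indep_def)
  then show "pt (x + 2) y \<notin> S" "pt (x - 2) y \<notin> S" "pt (x + 1) (y + 1) \<notin> S"
    "pt (x + 1) (y - 1) \<notin> S" "pt (x - 1) (y + 1) \<notin> S" "pt (x - 1) (y - 1) \<notin> S"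
    by (auto simp: neighbors_pt)
qed

lemma cls_indep: "indep (cls r)"
  unfolding indep_def
proof (intro conjI ballI cls_subset_V)
  fix v assume v: "v \<in> cls r"
  then obtain x y where "v = pt x y" using cls_subset_V V_pt_E by (meson subsetD)
  with v have "x mod 3 = r" by simp
  with \<open>v = pt x y\<close> show "N v \<inter> cls r = {}"
    by (auto simp: neighbors_pt) presburger+
qed

text \<open>
  Each class is a maximal independent set: a site of another class has a neighbour of the given
  class in the row above it. So a sweep that has occupied the whole class has reached exactly that
  class.
\<close>

lemma indep_superset_cls:
  assumes S: "indep S" and sub: "cls r \<subseteq> S" and r: "r \<in> {0, 1, 2}"
  shows "S = cls r"
proof (rule antisym[OF subsetI sub])
  fix v assume "v \<in> S"
  then obtain x y where v: "v = pt x y" "even (x + y)"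
    using S unfolding indep_def by (meson V_pt_E subsetD)
  have in_S: "pt a b \<in> S" if "even (a + b)" "a mod 3 = r" for a b
    using that sub by auto
  have "x mod 3 = r"
  proof (rule ccontr)
    assume "x mod 3 \<noteq> r"
    then have "(x + 1) mod 3 = r \<or> (x - 1) mod 3 = r" using r by auto presburger+
    then show False
      using in_S[of "x + 1" "y + 1"] in_S[of "x - 1" "y + 1"] indep_pt[OF S, of x y] v \<open>v \<in> S\<close> by auto
  qed
  then show "v \<in> cls r" using v by simp
qed

section \<open>Counting particles by rows and by columns\<close>

definition occ :: "site set \<Rightarrow> int \<Rightarrow> int \<Rightarrow> int" where
  "occ S x y = (if pt x y \<in> S then 1 else 0)"

definition row_count :: "site set \<Rightarrow> int \<Rightarrow> int" where
  "row_count S y = (\<Sum>i<6 * L. occ S (int i) y)"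

definition col_count :: "site set \<Rightarrow> int \<Rightarrow> int" where
  "col_count S x = (\<Sum>j<2 * K. occ S x (int j))"

definition full_row :: "site set \<Rightarrow> int \<Rightarrow> int \<Rightarrow> bool" where
  "full_row S y r \<longleftrightarrow> (\<forall>x. x mod 3 = r \<longrightarrow> even (x + y) \<longrightarrow> pt x y \<in> S)"

lemma occ_periodic [simp]: "occ S (x + 6 * int L) y = occ S x y" "occ S x (y + 2 * int K) = occ S x y"
  by (simp_all add: occ_def)

lemma row_count_periodic [simp]: "row_count S (y + 2 * int K) = row_count S y"
  by (simp add: row_count_def)

lemma col_count_periodic [simp]: "col_count S (x + 6 * int L) = col_count S x"
  by (simp add: col_count_def)

lemma card_eq_sum_occ:
  assumes "S \<subseteq> V"
  shows "int (card S) = (\<Sum>i<6 * L. \<Sum>j<2 * K. occ S (int i) (int j))"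
proof -
  have pt_id: "pt (int i) (int j) = (int i, int j)" if "i < 6 * L" "j < 2 * K" for i j
    using that by (simp add: pt_def)
  have "S = (\<lambda>(i, j). (int i, int j)) ` {(i, j). i < 6 * L \<and> j < 2 * K \<and> (int i, int j) \<in> S}"
  proof (intro equalityI subsetI)
    fix v assume v: "v \<in> S"
    then have "v \<in> V" using assms by blast
    then show "v \<in> (\<lambda>(i, j). (int i, int j)) ` {(i, j). i < 6 * L \<and> j < 2 * K \<and> (int i, int j) \<in> S}"
      using v by (intro image_eqI[of _ _ "(nat (fst v), nat (snd v))"]) (auto simp: sites_def)
  qed auto
  also have "card \<dots> = card {(i, j). i < 6 * L \<and> j < 2 * K \<and> (int i, int j) \<in> S}"
    by (rule card_image) (auto simp: inj_on_def)
  also have "{(i, j). i < 6 * L \<and> j < 2 * K \<and> (int i, int j) \<in> S}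
      = {v \<in> {..<6 * L} \<times> {..<2 * K}. case v of (i, j) \<Rightarrow> (int i, int j) \<in> S}"
    by auto
  also have "int (card \<dots>) = (\<Sum>v\<in>{..<6 * L} \<times> {..<2 * K}. if (case v of (i, j) \<Rightarrow> (int i, int j) \<in> S) then 1 else 0)"
    by (simp add: sum.If_cases Int_def)
  also have "\<dots> = (\<Sum>i<6 * L. \<Sum>j<2 * K. occ S (int i) (int j))"
    unfolding sum.cartesian_product by (rule sum.cong) (auto simp: occ_def pt_id)
  finally show ?thesis .
qed

lemma card_eq_sum_rows:
  assumes "S \<subseteq> V"
  shows "int (card S) = (\<Sum>j<K. row_count S (s + 2 * int j) + row_count S (s + 2 * int j + 1))"
proof -
  have per: "row_count S (x + int (K * 2)) = row_count S x" for x
    using row_count_periodic[of S x] by (simp add: mult.commute)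
  have "int (card S) = (\<Sum>j<2 * K. row_count S (int j))"
    unfolding card_eq_sum_occ[OF assms] row_count_def by (rule sum.swap)
  also have "\<dots> = (\<Sum>j<K. \<Sum>i<2. row_count S (s + 2 * int j + int i))"
    using sum_periodic_blocks[of "row_count S" K 2 s, OF per] by (simp add: mult.commute)
  finally show ?thesis by (simp add: numeral_2_eq_2)
qed

lemma card_eq_sum_cols:
  assumes "S \<subseteq> V"
  shows "int (card S) = (\<Sum>j<2 * L. col_count S (s + 3 * int j) + col_count S (s + 3 * int j + 1)
    + col_count S (s + 3 * int j + 2))"
proof -
  have per: "col_count S (x + int (2 * L * 3)) = col_count S x" for x
    using col_count_periodic[of S x] by (simp add: mult.commute)
  have "int (card S) = (\<Sum>j<2 * L * 3. col_count S (int j))"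
    unfolding card_eq_sum_occ[OF assms] col_count_def by (simp add: mult.commute)
  also have "\<dots> = (\<Sum>j<2 * L. \<Sum>i<3. col_count S (s + 3 * int j + int i))"
    using sum_periodic_blocks[of "col_count S" "2 * L" 3 s, OF per] by (simp add: mult.commute)
  finally show ?thesis by (simp add: numeral_3_eq_3 add.assoc)
qed

lemma row_count_insert:
  assumes "pt a b \<notin> S"
  shows "row_count (insert (pt a b) S) b = row_count S b + 1"
proof -
  define k where "k = nat (a mod (6 * int L))"
  have k: "k < 6 * L" "int k = a mod (6 * int L)"
    using L1 by (auto simp: k_def nat_less_iff)
  have "occ (insert (pt a b) S) (int i) b = occ S (int i) b + (if i = k then 1 else 0)" if "i < 6 * L" for i
  proof -
    have "int i mod (6 * int L) = int i" using that by simp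
    then have "pt (int i) b = pt a b \<longleftrightarrow> i = k" using k by (auto simp: pt_eq_iff)
    then show ?thesis using assms by (auto simp: occ_def)
  qed
  then have "row_count (insert (pt a b) S) b = (\<Sum>i<6 * L. occ S (int i) b + (if i = k then 1 else 0))"
    unfolding row_count_def by (intro sum.cong) auto
  also have "\<dots> = row_count S b + 1"
    using k by (simp add: sum.distrib row_count_def)
  finally show ?thesis .
qed

lemma row_count_mono: "S \<subseteq> T \<Longrightarrow> row_count S y \<le> row_count T y"
  unfolding row_count_def by (intro sum_mono) (auto simp: occ_def)

text \<open>
  In two adjacent rows the three columns \<open>x\<close>, \<open>x + 1\<close>, \<open>x +
  2\<close> contain a single triangle of pairwise adjacent sites; the other three points have the
  wrong parity and are not sites.
\<close>

lemma triple_rows: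
  assumes "indep S"
  shows "occ S x y + occ S x (y + 1) + (occ S (x + 1) y + occ S (x + 1) (y + 1))
    + (occ S (x + 2) y + occ S (x + 2) (y + 1)) \<le> 1"
proof (cases "even (x + y)")
  case True
  then have "pt x (y + 1) \<notin> S" "pt (x + 1) y \<notin> S" "pt (x + 2) (y + 1) \<notin> S"
    using indep_pt_even[OF assms, of x "y + 1"] indep_pt_even[OF assms, of "x + 1" y]
      indep_pt_even[OF assms, of "x + 2" "y + 1"] by auto
  moreover have "pt x y \<in> S \<Longrightarrow> pt (x + 1) (y + 1) \<notin> S" "pt x y \<in> S \<Longrightarrow> pt (x + 2) y \<notin> S"
    using indep_pt[OF assms, of x y] by auto
  moreover have "pt (x + 1) (y + 1) \<in> S \<Longrightarrow> pt (x + 2) y \<notin> S"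
    using indep_pt(4)[OF assms, of "x + 1" "y + 1"] by (simp add: ac_simps)
  ultimately show ?thesis by (simp add: occ_def)
next
  case False
  then have "pt x y \<notin> S" "pt (x + 1) (y + 1) \<notin> S" "pt (x + 2) y \<notin> S"
    using indep_pt_even[OF assms, of x y] indep_pt_even[OF assms, of "x + 1" "y + 1"]
      indep_pt_even[OF assms, of "x + 2" y] by auto
  moreover have "pt x (y + 1) \<in> S \<Longrightarrow> pt (x + 1) y \<notin> S" "pt x (y + 1) \<in> S \<Longrightarrow> pt (x + 2) (y + 1) \<notin> S"
    using indep_pt[OF assms, of x "y + 1"] by auto
  moreover have "pt (x + 1) y \<in> S \<Longrightarrow> pt (x + 2) (y + 1) \<notin> S"
    using indep_pt(3)[OF assms, of "x + 1" y] by (simp add: ac_simps)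
  ultimately show ?thesis by (simp add: occ_def)
qed

text \<open>
  Sum \<open>triple_rows\<close> over the \<open>6L\<close> triples: each site lies in three of
  them. If the sum is attained, consecutive triples differ by the exchange of \<open>x\<close> for
  \<open>x + 3\<close>, so the occupation of the zigzag has period 3.
\<close>

lemma pair_of_rows_le:
  assumes "indep S"
  shows "row_count S y + row_count S (y + 1) \<le> 2 * int L"
    and "row_count S y + row_count S (y + 1) \<ge> 2 * int L \<Longrightarrow>
      \<exists>r\<in>{0, 1, 2}. full_row S y r \<and> full_row S (y + 1) r"
proof -
  define g where "g x = occ S x y + occ S x (y + 1)" for x
  define t where "t x = g x + g (x + 1) + g (x + 2)" for x
  have t_le: "t x \<le> 1" for x using triple_rows[OF assms, of x y] by (simp add: t_def g_def)
  have g_per: "g (x + int (6 * L)) = g x" for x by (simp add: g_def)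
  have g_sum: "(\<Sum>i<6 * L. g (s + int i)) = row_count S y + row_count S (y + 1)" for s
    using sum_periodic_shift[of g "6 * L" s] g_per by (simp add: g_def row_count_def sum.distrib)
  have t_sum: "(\<Sum>i<6 * L. t (s + int i)) = 3 * (row_count S y + row_count S (y + 1))" for s
    using g_sum[of s] g_sum[of "s + 1"] g_sum[of "s + 2"]
    by (simp add: t_def sum.distrib algebra_simps)
  have "(\<Sum>i<6 * L. t (0 + int i)) \<le> (\<Sum>i<6 * L. 1)" by (intro sum_mono t_le)
  then show "row_count S y + row_count S (y + 1) \<le> 2 * int L" unfolding t_sum by simp
  assume full: "row_count S y + row_count S (y + 1) \<ge> 2 * int L"
  have t_eq: "t x = 1" for x
    using sum_all_eq[of "{..<6 * L}" "\<lambda>i. t (x + int i)" 1 0] t_sum[of x] full t_le L1 by simp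
  \<comment> \<open>The triples at \<open>x\<close> and at \<open>x + 1\<close> share two of their three
    terms.\<close>
  then have g_step: "g (x + 3) = g x" for x
  proof -
    have "g x + (g (x + 1) + g (x + 2)) = 1" "g (x + 1) + (g (x + 2) + g (x + 3)) = 1"
      using t_eq[of x] t_eq[of "x + 1"] by (simp_all add: t_def add.assoc)
    then show ?thesis by linarith
  qed
  have g_3k: "g (x + 3 * k) = g x" for x k
    using periodic_mult[of g 3] g_step by blast
  have "g 0 = 1 \<or> g 1 = 1 \<or> g 2 = 1"
    using t_eq[of 0] unfolding t_def by (auto simp: g_def occ_def split: if_splits)
  then obtain r where r: "r \<in> {0, 1, 2}" "g r = 1" by auto
  have g1: "g x = 1" if "x mod 3 = r" for x
    using g_3k[of r "x div 3"] r that by (metis add.commute mult_div_mod_eq)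
  have "full_row S y r \<and> full_row S (y + 1) r"
    unfolding full_row_def
  proof (intro conjI allI impI)
    fix x assume "x mod 3 = r" "even (x + y)"
    then show "pt x y \<in> S" using g1[of x] indep_pt_even[OF assms, of x "y + 1"]
      by (auto simp: g_def occ_def split: if_splits)
  next
    fix x assume "x mod 3 = r" "even (x + (y + 1))"
    then show "pt x (y + 1) \<in> S" using g1[of x] indep_pt_even[OF assms, of x y]
      by (auto simp: g_def occ_def split: if_splits)
  qed
  with r show "\<exists>r\<in>{0, 1, 2}. full_row S y r \<and> full_row S (y + 1) r" by blast
qed

text \<open>
  One of every six consecutive points of a row is a site of the given class.
\<close>

lemma full_row_count:
  assumes "full_row S y r" "r \<in> {0, 1, 2}"
  shows "row_count S y \<ge> int L"
proof -
  obtain s where s: "s mod 3 = r" "even (s + y)"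
  proof (cases "even (r + y)")
    case True then show ?thesis using that[of r] assms by auto
  next
    case False then show ?thesis using that[of "r + 3"] assms by auto
  qed
  have per: "occ S (x + int (L * 6)) y = occ S x y" for x
    using occ_periodic(1)[of S x y] by (simp add: mult.commute)
  have "row_count S y = (\<Sum>j<L. \<Sum>i<6. occ S (s + 6 * int j + int i) y)"
    unfolding row_count_def using sum_periodic_blocks[of "\<lambda>x. occ S x y" L 6 s, OF per]
    by (simp add: mult.commute)
  also have "\<dots> \<ge> (\<Sum>j<L. 1)"
  proof (intro sum_mono)
    fix j
    have "(s + 6 * int j) mod 3 = r" "even (s + 6 * int j + y)" using s by (presburger, simp)
    then have "occ S (s + 6 * int j + int 0) y = 1" using assms by (simp add: occ_def full_row_def)
    moreover have "occ S (s + 6 * int j + int 0) y \<le> (\<Sum>i<6. occ S (s + 6 * int j + int i) y)"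
      by (rule member_le_sum) (auto simp: occ_def)
    ultimately show "1 \<le> (\<Sum>i<6. occ S (s + 6 * int j + int i) y)" by linarith
  qed
  finally show ?thesis by simp
qed

text \<open>
  Every site outside class \<open>s\<close> is adjacent to a site of class \<open>s\<close> in its
  own row and also in each of the two neighbouring rows, so a full row excludes the other classes
  from three rows.
\<close>

lemma full_row_class:
  assumes S: "indep S" and full: "full_row S y s" and s: "s \<in> {0, 1, 2}"
    and p: "pt x u \<in> S" "u = y \<or> u = y + 1 \<or> u = y - 1"
  shows "x mod 3 = s"
proof (rule ccontr)
  assume ne: "x mod 3 \<noteq> s"
  have ev: "even (x + u)" using indep_pt_even[OF S p(1)] .
  have "(x + 1) mod 3 = s \<and> (x - 2) mod 3 = s \<or> (x - 1) mod 3 = s \<and> (x + 2) mod 3 = s"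
    using ne s by auto presburger+
  then show False
    using p(2) ev full indep_pt[OF S p(1)] unfolding full_row_def
    by (elim disjE conjE) auto
qed

lemma full_row_unique:
  assumes S: "indep S" and "full_row S y r" "full_row S y s" "r \<in> {0, 1, 2}" "s \<in> {0, 1, 2}"
  shows "r = s"
proof -
  have "\<exists>x. x mod 3 = r \<and> even (x + y)"
    using assms(4) by (intro exI[of _ "if even (r + y) then r else r + 3"]) auto
  then obtain x where "x mod 3 = r" "even (x + y)" by blast
  then show ?thesis using full_row_class[OF S assms(3,5), of x y] assms(2) by (auto simp: full_row_def)
qed

lemma full_row_periodic:
  assumes "y mod (2 * int K) = y' mod (2 * int K)" "full_row S y r"
  shows "full_row S y' r"
proof -
  have "even (y - y')" using assms(1) by (metis dvd_mult_left mod_eq_dvd_iff)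
  moreover have "pt x y = pt x y'" for x using assms(1) by (simp add: pt_eq_iff)
  ultimately show ?thesis using assms(2) unfolding full_row_def
    by (metis even_add even_diff)
qed

lemma full_row_mono: "full_row S y r \<Longrightarrow> S \<subseteq> T \<Longrightarrow> full_row T y r"
  unfolding full_row_def by blast

lemma full_row_insert:
  assumes "full_row (insert (pt a b) S) y r" "y mod (2 * int K) \<noteq> b mod (2 * int K)"
  shows "full_row S y r"
  using assms unfolding full_row_def by (auto simp: pt_eq_iff)

lemma triple_cols:
  assumes "indep S"
  shows "occ S x y + occ S (x + 1) y + occ S (x + 2) y
    + (occ S x (y + 1) + occ S (x + 1) (y + 1) + occ S (x + 2) (y + 1)) \<le> 1"
  using triple_rows[OF assms, of x y] by simp

text \<open>
  The column analogue of \<open>pair_of_rows_le\<close>, with \<open>h y\<close> the number of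
  particles of the three columns in row \<open>y\<close>. If the bound is attained,
  \<open>h\<close> alternates between 0 and 1. The rows in which the middle column has sites are
  those of one parity, so the middle column is full or empty; when it is empty, the particles may
  choose freely between the two outer columns.
\<close>

lemma window_le:
  assumes "indep S"
  shows "col_count S x + col_count S (x + 1) + col_count S (x + 2) \<le> int K"
    and "col_count S x + col_count S (x + 1) + col_count S (x + 2) \<ge> int K \<Longrightarrow>
      pt (x + 1) u \<in> S \<Longrightarrow> even (u + u') \<Longrightarrow> pt (x + 1) u' \<in> S"
proof -
  define h where "h y = occ S x y + occ S (x + 1) y + occ S (x + 2) y" for y
  have h_le: "h y + h (y + 1) \<le> 1" for y using triple_cols[OF assms, of x y] by (simp add: h_def)
  have h_per: "h (y + int (2 * K)) = h y" for y by (simp add: h_def)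
  have h_sum: "(\<Sum>i<2 * K. h (s + int i)) = col_count S x + col_count S (x + 1) + col_count S (x + 2)" for s
    using sum_periodic_shift[of h "2 * K" s] h_per by (simp add: h_def col_count_def sum.distrib)
  have hh_sum: "(\<Sum>i<2 * K. h (s + int i) + h (s + int i + 1))
      = 2 * (col_count S x + col_count S (x + 1) + col_count S (x + 2))" for s
    using h_sum[of s] h_sum[of "s + 1"] by (simp add: sum.distrib algebra_simps)
  have "(\<Sum>i<2 * K. h (0 + int i) + h (0 + int i + 1)) \<le> (\<Sum>i<2 * K. 1)" by (intro sum_mono h_le)
  then show "col_count S x + col_count S (x + 1) + col_count S (x + 2) \<le> int K"
    unfolding hh_sum by simp
  assume full: "col_count S x + col_count S (x + 1) + col_count S (x + 2) \<ge> int K"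
    and u: "pt (x + 1) u \<in> S" "even (u + u')"
  have h_eq: "h y + h (y + 1) = 1" for y
    using sum_all_eq[of "{..<2 * K}" "\<lambda>i. h (y + int i) + h (y + int i + 1)" 1 0] hh_sum[of y] full h_le K2
    by simp
  have h_step: "h (y + 2) = h y" for y
  proof -
    have "h y + h (y + 1) = 1" "h (y + 1) + h (y + 2) = 1"
      using h_eq[of y] h_eq[of "y + 1"] by (simp_all add: add.assoc)
    then show ?thesis by linarith
  qed
  have h_2k: "h (y + 2 * k) = h y" for y k
    using periodic_mult[of h 2] h_step by blast
  have ev: "even (x + 1 + u)" using indep_pt_even[OF assms u(1)] .
  have "even (u' - u)" using u(2) by simp
  then obtain k where "u' - u = 2 * k" by (elim evenE)
  then have k: "u' = u + 2 * k" by simp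
  have "h u \<ge> 1" using u by (auto simp: h_def occ_def)
  then have "h u' \<ge> 1" unfolding k h_2k .
  moreover have "pt x u' \<notin> S" "pt (x + 2) u' \<notin> S"
    using indep_pt_even[OF assms, of x u'] indep_pt_even[OF assms, of "x + 2" u'] ev u(2) by auto
  ultimately show "pt (x + 1) u' \<in> S" by (auto simp: h_def occ_def split: if_splits)
qed

lemma card_le_max:
  assumes "indep S"
  shows "int (card S) \<le> 2 * int K * int L"
proof -
  have "S \<subseteq> V" using assms by (simp add: indep_def)
  have "int (card S) \<le> (\<Sum>j<K. 2 * int L)"
    unfolding card_eq_sum_rows[OF \<open>S \<subseteq> V\<close>, of 0] by (intro sum_mono pair_of_rows_le(1) assms)
  then show ?thesis by simp
qed

lemma exists_full_pair_of_rows: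
  assumes S: "indep S" and "int (card S) > 2 * int K * int L - int K"
  shows "\<exists>y. \<exists>r\<in>{0, 1, 2}. full_row S y r \<and> full_row S (y + 1) r"
proof (rule ccontr)
  assume none: "\<not> ?thesis"
  have "S \<subseteq> V" using S by (simp add: indep_def)
  have "int (card S) \<le> (\<Sum>j<K. 2 * int L - 1)"
    unfolding card_eq_sum_rows[OF \<open>S \<subseteq> V\<close>, of 0]
  proof (rule sum_mono)
    fix j
    show "row_count S (0 + 2 * int j) + row_count S (0 + 2 * int j + 1) \<le> 2 * int L - 1"
      using pair_of_rows_le(2)[OF S, of "0 + 2 * int j"] none by force
  qed
  with assms(2) show False by (simp add: algebra_simps)
qed

lemma exists_full_window:
  assumes S: "indep S" and "int (card S) > 2 * int K * int L - 2 * int L"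
  shows "\<exists>x. x mod 3 = s mod 3 \<and> col_count S x + col_count S (x + 1) + col_count S (x + 2) \<ge> int K"
proof (rule ccontr)
  assume none: "\<not> ?thesis"
  have "S \<subseteq> V" using S by (simp add: indep_def)
  have "int (card S) \<le> (\<Sum>j<2 * L. int K - 1)"
    unfolding card_eq_sum_cols[OF \<open>S \<subseteq> V\<close>, of s]
  proof (rule sum_mono)
    fix j
    have "(s + 3 * int j) mod 3 = s mod 3" by simp
    then show "col_count S (s + 3 * int j) + col_count S (s + 3 * int j + 1) + col_count S (s + 3 * int j + 2)
        \<le> int K - 1"
      using none[simplified, rule_format, of "s + 3 * int j"] by simp
  qed
  with assms(2) show False by (simp add: algebra_simps)
qed

lemma card_cls: "r \<in> {0, 1, 2} \<Longrightarrow> int (card (cls r)) = 2 * int K * int L"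
proof (rule antisym[OF card_le_max[OF cls_indep]])
  assume r: "r \<in> {0, 1, 2}"
  have "full_row (cls r) y r" for y by (simp add: full_row_def)
  then have L: "row_count (cls r) y \<ge> int L" for y using full_row_count r by blast
  have "int (card (cls r)) \<ge> (\<Sum>j<K. int L + int L)"
    unfolding card_eq_sum_rows[OF cls_subset_V, of _ 0] by (intro sum_mono add_mono L)
  then show "2 * int K * int L \<le> int (card (cls r))" by simp
qed

text \<open>
  All pairs of adjacent rows are full, also the overlapping ones, and two overlapping pairs have a
  row in common, which fixes their class.
\<close>

lemma max_card_imp_cls:
  assumes S: "indep S" and card: "int (card S) = 2 * int K * int L"
  shows "\<exists>r\<in>{0, 1, 2}. S = cls r"
proof -
  have "S \<subseteq> V" using S by (simp add: indep_def)
  have "row_count S y + row_count S (y + 1) = 2 * int L" for y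
    using sum_all_eq[of "{..<K}" "\<lambda>j. row_count S (y + 2 * int j) + row_count S (y + 2 * int j + 1)" "2 * int L" 0]
      card card_eq_sum_rows[OF \<open>S \<subseteq> V\<close>, of y] pair_of_rows_le(1)[OF S] K2
    by (simp add: mult.commute)
  then have ex: "\<exists>r\<in>{0, 1, 2}. full_row S y r \<and> full_row S (y + 1) r" for y
    using pair_of_rows_le(2)[OF S] by simp
  then obtain r where r: "r \<in> {0, 1, 2}" "full_row S 0 r" by blast
  have step: "full_row S (y + 1) r \<longleftrightarrow> full_row S y r" for y
  proof -
    obtain t where "t \<in> {0, 1, 2}" "full_row S y t" "full_row S (y + 1) t" using ex[of y] by blast
    then show ?thesis using full_row_unique[OF S _ _ r(1), of _ t] by metis
  qed
  have "full_row S y r" for y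
  proof (induction y rule: int_induct[where k = 0])
    case (step1 i) then show ?case using step[of i] by simp
  next
    case (step2 i) then show ?case using step[of "i - 1"] by simp
  qed (rule r)
  have "cls r \<subseteq> S"
  proof
    fix v assume v: "v \<in> cls r"
    then obtain x y where "v = pt x y" using cls_subset_V V_pt_E by (meson subsetD)
    with v \<open>\<And>y. full_row S y r\<close> show "v \<in> S" by (auto simp: full_row_def)
  qed
  then show ?thesis using indep_superset_cls[OF S] r by blast
qed

section \<open>Moves, and filling a set of sites one swap at a time\<close>

text \<open>
  The bound \<open>h\<close> is on the number of particles, so that it is minus a bound on the
  energy.
\<close>

definition move :: "int \<Rightarrow> site set \<Rightarrow> site set \<Rightarrow> bool" where
  "move h S T \<longleftrightarrow> indep S \<and> indep T \<and> h \<le> int (card S) \<and> h \<le> int (card T) \<and>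
     (\<exists>v. v \<notin> S \<and> T = insert v S \<or> v \<notin> T \<and> S = insert v T)"

definition reach :: "int \<Rightarrow> site set \<Rightarrow> site set \<Rightarrow> bool" where
  "reach h = (move h)\<^sup>*\<^sup>*"

lemma reach_refl [simp]: "reach h S S"
  by (simp add: reach_def)

lemma reach_trans: "reach h S T \<Longrightarrow> reach h T U \<Longrightarrow> reach h S U"
  unfolding reach_def by (rule rtranclp_trans)

lemma reach_sym: "reach h S T \<Longrightarrow> reach h T S"
proof -
  have "symp (move h)" unfolding symp_def move_def by blast
  then show "reach h S T \<Longrightarrow> reach h T S" unfolding reach_def by (metis symp_rtranclp sympD)
qed

lemma reach_weaken: "reach h S T \<Longrightarrow> h' \<le> h \<Longrightarrow> reach h' S T"
  unfolding reach_def by (rule mono_rtranclp[rule_format]) (auto simp: move_def)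

lemma reach_insert:
  assumes "indep (insert v S)"
  shows "reach (int (card S)) S (insert v S)"
proof (cases "v \<in> S")
  case True then show ?thesis by (simp add: insert_absorb)
next
  case False
  have "indep S" using assms by (rule indep_subset) auto
  moreover have "int (card S) \<le> int (card (insert v S))" by (simp add: card_insert_le)
  ultimately have "move (int (card S)) S (insert v S)"
    using False assms unfolding move_def by blast
  then show ?thesis by (simp add: reach_def)
qed

lemma int_card_Diff:
  assumes "indep S" "A \<subseteq> S"
  shows "int (card (S - A)) = int (card S) - int (card A)"
proof -
  have "finite S" "finite A" using assms indep_finite finite_subset by blast+
  then show ?thesis using assms(2) by (simp add: card_Diff_subset of_nat_diff card_mono)
qed

lemma reach_remove:
  assumes "indep S" "A \<subseteq> S"
  shows "reach (int (card S) - int (card A)) S (S - A)"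
proof -
  have fin: "finite A" using assms indep_finite finite_subset by blast
  show ?thesis
    using fin assms(2)
  proof (induction A rule: finite_induct)
    case (insert a A)
    have a: "a \<in> S - A" and A: "A \<subseteq> S" using insert by auto
    have eq: "insert a (S - insert a A) = S - A" using a by blast
    have "int (card (S - insert a A)) = int (card S) - int (card (insert a A))"
      using insert.prems by (rule int_card_Diff[OF assms(1)])
    moreover have "indep (S - A)" using assms(1) by (rule indep_subset) auto
    ultimately have "reach (int (card S) - int (card (insert a A))) (S - A) (S - insert a A)"
      using reach_insert[of a "S - insert a A"] unfolding eq by (metis reach_sym)
    moreover have "reach (int (card S) - int (card (insert a A))) S (S - A)"
      using insert.IH[OF A] by (rule reach_weaken) (use insert in simp)
    ultimately show ?case using reach_trans by blast
  qed simp
qed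

lemma indep_insert:
  assumes "indep S" "v \<in> V" "N v \<inter> S = {}"
  shows "indep (insert v S)"
  unfolding indep_def
proof (intro conjI ballI)
  show "insert v S \<subseteq> V" using assms by (auto simp: indep_def)
  fix u assume u: "u \<in> insert v S"
  have "v \<notin> N u" if "u \<in> S" using neighbors_sym[of u v] assms that by (auto simp: indep_def)
  then show "N u \<inter> insert v S = {}"
    using u assms neighbors_irrefl[OF assms(2)] by (auto simp: indep_def)
qed

text \<open>
  If \<open>v\<close> has an occupied neighbour then \<open>v\<close> itself is empty, so the
  particle removed for \<open>v\<close> is made up for by the particle placed at \<open>v\<close>.
\<close>

lemma swap_in:
  assumes S: "indep S" and v: "v \<in> V" and one: "\<And>p q. p \<in> N v \<inter> S \<Longrightarrow> q \<in> N v \<inter> S \<Longrightarrow> p = q"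
  shows "indep (insert v (S - N v))" "card S \<le> card (insert v (S - N v))"
    "reach (int (card S) - 1) S (insert v (S - N v))"
proof -
  define A where "A = N v \<inter> S"
  have finS: "finite S" using S indep_finite by blast
  have SA: "S - N v = S - A" by (auto simp: A_def)
  have cA: "card A \<le> 1" using one finS card_le_Suc0_iff_eq[of A] by (auto simp: A_def)
  have cSA: "card (S - A) = card S - card A" "card A \<le> card S"
    using finS by (auto simp: A_def card_Diff_subset card_mono)
  show ind: "indep (insert v (S - N v))"
    by (rule indep_insert[OF indep_subset[OF S] v]) auto
  show "card S \<le> card (insert v (S - N v))"
  proof (cases "A = {}")
    case True
    then show ?thesis using finS by (simp add: SA card_insert_le)
  next
    case False
    then have "v \<notin> S" using S by (auto simp: A_def indep_def)
    then show ?thesis using finS cA cSA by (simp add: SA)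
  qed
  have "reach (int (card S) - 1) S (S - A)"
    using reach_remove[OF S, of A] by (rule reach_weaken) (use cA in \<open>auto simp: A_def\<close>)
  moreover have "reach (int (card S) - 1) (S - A) (insert v (S - A))"
    using reach_insert[OF ind[unfolded SA]] by (rule reach_weaken) (use cA cSA in auto)
  ultimately show "reach (int (card S) - 1) S (insert v (S - N v))"
    unfolding SA by (rule reach_trans)
qed

text \<open>
  The sites of \<open>T\<close> are to be occupied in the order of increasing \<open>rank\<close>,
  clearing the neighbours of each. The condition says that at the turn of \<open>v\<close> at most
  one of its neighbours is still occupied: occupied neighbours of \<open>v\<close> that are also
  neighbours of an earlier site have already been cleared.
\<close>

definition swap_order :: "(site \<Rightarrow> nat) \<Rightarrow> site set \<Rightarrow> site set \<Rightarrow> bool" where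
  "swap_order rank S T \<longleftrightarrow> (\<forall>v\<in>T. \<forall>p\<in>N v \<inter> S. \<forall>q\<in>N v \<inter> S.
     (\<forall>u\<in>T. rank u < rank v \<longrightarrow> p \<notin> N u \<and> q \<notin> N u) \<longrightarrow> p = q)"

lemma swap_orderD:
  assumes "swap_order rank S T" "v \<in> T" "p \<in> N v \<inter> S" "q \<in> N v \<inter> S"
    and "\<And>u. u \<in> T \<Longrightarrow> rank u < rank v \<Longrightarrow> p \<notin> N u \<and> q \<notin> N u"
  shows "p = q"
  using assms unfolding swap_order_def by blast

text \<open>
  Induction on \<open>T\<close>, occupying a site \<open>v\<close> of least rank first. Each swap
  leaves at least as many particles as before, so the missing particles do not accumulate: one is
  the worst that is ever missing.
\<close>

lemma fill:
  assumes S: "indep S" and T: "indep T" and order: "swap_order rank S T"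
  shows "indep (S - \<Union>(N ` T) \<union> T)" "card S \<le> card (S - \<Union>(N ` T) \<union> T)"
    "reach (int (card S) - 1) S (S - \<Union>(N ` T) \<union> T)"
proof -
  have "finite T" using T indep_finite by blast
  then have "indep (S - \<Union>(N ` T) \<union> T) \<and> card S \<le> card (S - \<Union>(N ` T) \<union> T)
    \<and> reach (int (card S) - 1) S (S - \<Union>(N ` T) \<union> T)"
    using S T order
  proof (induction T arbitrary: S rule: finite_psubset_induct)
    case (psubset T)
    show ?case
    proof (cases "T = {}")
      case True
      then show ?thesis using psubset.prems by simp
    next
      case False
      then obtain v where v: "v \<in> T" and v_min: "\<And>u. u \<in> T \<Longrightarrow> rank v \<le> rank u"
        using psubset.hyps arg_min_if_finite(1)[of T rank] arg_min_least[of T _ rank] by blast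
      have vV: "v \<in> V" using v psubset.prems(2) by (auto simp: indep_def)
      define S1 where "S1 = insert v (S - N v)"
      have S1: "indep S1" "card S \<le> card S1" "reach (int (card S) - 1) S S1"
        unfolding S1_def using swap_orderD[OF psubset.prems(3) v] v_min
        by (intro swap_in[OF psubset.prems(1) vV]; meson not_less)+
      have v_nonadj: "v \<notin> N u" if "u \<in> T" for u
        using psubset.prems(2) v that by (auto simp: indep_def)
      have set_eq: "S1 - \<Union>(N ` (T - {v})) \<union> (T - {v}) = S - \<Union>(N ` T) \<union> T"
        using v v_nonadj by (auto simp: S1_def)
      have IH: "indep (S1 - \<Union>(N ` (T - {v})) \<union> (T - {v}))
          \<and> card S1 \<le> card (S1 - \<Union>(N ` (T - {v})) \<union> (T - {v}))
          \<and> reach (int (card S1) - 1) S1 (S1 - \<Union>(N ` (T - {v})) \<union> (T - {v}))"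
      proof (rule psubset.IH)
        show "T - {v} \<subset> T" using v by blast
        show "indep S1" by (rule S1)
        show "indep (T - {v})" using psubset.prems(2) by (rule indep_subset) auto
        show "swap_order rank S1 (T - {v})"
          unfolding swap_order_def
        proof (intro ballI impI)
          fix w p q
          assume w: "w \<in> T - {v}" and p: "p \<in> N w \<inter> S1" and q: "q \<in> N w \<inter> S1"
            and later: "\<forall>u\<in>T - {v}. rank u < rank w \<longrightarrow> p \<notin> N u \<and> q \<notin> N u"
          have pq: "p \<in> S - N v" "q \<in> S - N v" using p q w v_nonadj[of w] unfolding S1_def by blast+
          show "p = q"
          proof (rule swap_orderD[OF psubset.prems(3), of w])
            show "w \<in> T" "p \<in> N w \<inter> S" "q \<in> N w \<inter> S" using w p q pq by auto
            show "p \<notin> N u \<and> q \<notin> N u" if "u \<in> T" "rank u < rank w" for u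
              using later that pq by (cases "u = v") auto
          qed
        qed
      qed
      then have "reach (int (card S) - 1) S1 (S - \<Union>(N ` T) \<union> T)"
        unfolding set_eq using S1(2) reach_weaken by (metis diff_right_mono of_nat_mono)
      then show ?thesis using IH S1 unfolding set_eq by (auto intro: reach_trans)
    qed
  qed
  then show "indep (S - \<Union>(N ` T) \<union> T)" "card S \<le> card (S - \<Union>(N ` T) \<union> T)"
    "reach (int (card S) - 1) S (S - \<Union>(N ` T) \<union> T)" by auto
qed

section \<open>Sweeping by rows\<close>

definition row :: "int \<Rightarrow> site set" where
  "row y = {pt x y |x. even (x + y)}"

definition col :: "int \<Rightarrow> site set" where
  "col x = {pt x y |y. even (x + y)}"

lemma pt_in_rowI: "even (x + y) \<Longrightarrow> pt x y \<in> row y"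
  by (auto simp: row_def)

lemma pt_in_colI: "even (x + y) \<Longrightarrow> pt x y \<in> col x"
  by (auto simp: col_def)

lemma neighbors_ptI:
  "(a - c, b - d) \<in> {(2, 0), (-2, 0), (1, 1), (1, -1), (-1, 1), (-1, -1)} \<Longrightarrow> pt a b \<in> N (pt c d)"
  unfolding neighbors_pt by (auto simp: algebra_simps)

lemma indep_ptD:
  assumes "indep S" "pt a b \<in> S" "pt c d \<in> S"
  shows "(a - c, b - d) \<notin> {(2, 0), (-2, 0), (1, 1), (1, -1), (-1, 1), (-1, -1)}"
proof
  assume "(a - c, b - d) \<in> {(2, 0), (-2, 0), (1, 1), (1, -1), (-1, 1), (-1, -1)}"
  from neighbors_ptI[OF this] assms show False by (auto simp: indep_def)
qed

lemma pt_mod_row: "pt x (y0 + (y - y0) mod (2 * int K)) = pt x y"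
  by (simp add: pt_eq_iff mod_simps)

lemma rank_pt: "(snd (pt x y) - y0) mod (2 * int K) = (y - y0) mod (2 * int K)"
  by (simp add: pt_def mod_simps)

text \<open>
  Once row \<open>y0 + i - 1\<close> has been filled with class \<open>r\<close>, the neighbours
  of a class \<open>r\<close> site in row \<open>y0 + i\<close> which lie in that row or in the
  row below have been cleared. The two neighbours in the row above are adjacent to each other, so
  at most one is occupied. For the first row the removal of \<open>D\<close> plays the part of the
  missing filled row.
\<close>

lemma horizontal_sweep:
  assumes S: "indep S" and r: "r \<in> {0, 1, 2}"
    and D: "D = (S - cls r) \<inter> (row (y0 - 1) \<union> row y0)"
  shows "reach (int (card S) - int (card D) - 1) S (cls r)"
proof -
  define rank where "rank v = nat ((snd v - y0) mod (2 * int K))" for v :: site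
  have DS: "D \<subseteq> S" by (auto simp: D)
  have S': "indep (S - D)" using S by (rule indep_subset) auto
  have card: "int (card (S - D)) = int (card S) - int (card D)"
    using S DS by (rule int_card_Diff)
  have "swap_order rank (S - D) (cls r)"
    unfolding swap_order_def
  proof (intro ballI impI)
    fix v p q
    assume v: "v \<in> cls r" and p: "p \<in> N v \<inter> (S - D)" and q: "q \<in> N v \<inter> (S - D)"
      and new: "\<forall>u\<in>cls r. rank u < rank v \<longrightarrow> p \<notin> N u \<and> q \<notin> N u"
    obtain x y where xy: "v = pt x y" using v cls_subset_V V_pt_E by (meson subsetD)
    define i where "i = (y - y0) mod (2 * int K)"
    have i: "0 \<le> i" "i < 2 * int K" using K2 by (auto simp: i_def)
    have v_pt: "v = pt x (y0 + i)" by (simp add: xy i_def pt_mod_row)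
    have rank_v: "rank v = nat i" by (simp add: rank_def xy rank_pt i_def)
    have x: "x mod 3 = r" "even (x + (y0 + i))" using v unfolding v_pt by auto
    have upper: "p = pt (x + 1) (y0 + i + 1) \<or> p = pt (x - 1) (y0 + i + 1)"
      if p: "p \<in> N v \<inter> (S - D)" and new: "\<And>u. u \<in> cls r \<Longrightarrow> rank u < rank v \<Longrightarrow> p \<notin> N u" for p
    proof (rule ccontr)
      assume "\<not> ?thesis"
      then have p_cases: "p \<in> {pt (x + 2) (y0 + i), pt (x + 1) (y0 + i - 1),
          pt (x - 2) (y0 + i), pt (x - 1) (y0 + i - 1)}"
        using p unfolding v_pt neighbors_pt by auto
      show False
      proof (cases "i = 0")
        case True
        have "(x + 2) mod 3 \<noteq> r" "(x + 1) mod 3 \<noteq> r" "(x - 2) mod 3 \<noteq> r" "(x - 1) mod 3 \<noteq> r"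
          using x(1) by presburger+
        then have "p \<notin> cls r" using p_cases by (elim insertE) auto
        moreover have "p \<in> row (y0 - 1) \<union> row y0"
          using p_cases True x(2) pt_in_rowI[of "x + 2" y0] pt_in_rowI[of "x - 2" y0]
            pt_in_rowI[of "x + 1" "y0 - 1"] pt_in_rowI[of "x - 1" "y0 - 1"]
          by (elim insertE) auto
        ultimately have "p \<in> D" using p by (simp add: D)
        then show False using p by simp
      next
        case False
        \<comment> \<open>Both sites belong to the class and to the row below; between them they are adjacent
          to all four left and right neighbours of \<open>v\<close> in the rows \<open>y0 +
          i\<close> and \<open>y0 + i - 1\<close>.\<close>
        define u1 u2 where "u1 = pt (x + 3) (y0 + (i - 1))" and "u2 = pt (x - 3) (y0 + (i - 1))"
        have "rank u1 = nat (i - 1)" "rank u2 = nat (i - 1)"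
          using i False by (auto simp: rank_def u1_def u2_def rank_pt)
        then have "rank u1 < rank v" "rank u2 < rank v" using rank_v i False by auto
        moreover have "u1 \<in> cls r" "u2 \<in> cls r"
          using x by (auto simp: u1_def u2_def)
        ultimately have "p \<notin> N u1" "p \<notin> N u2" using new by auto
        moreover have "p \<in> N u1 \<or> p \<in> N u2"
        proof -
          have "pt (x + 2) (y0 + i) \<in> N u1" "pt (x + 1) (y0 + i - 1) \<in> N u1"
            "pt (x - 2) (y0 + i) \<in> N u2" "pt (x - 1) (y0 + i - 1) \<in> N u2"
            unfolding u1_def u2_def by (rule neighbors_ptI; simp)+
          then show ?thesis using p_cases by auto
        qed
        ultimately show False by blast
      qed
    qed
    show "p = q"
    proof (rule ccontr)
      have nonadj: "pt (x + 1) (y0 + i + 1) \<notin> S \<or> pt (x - 1) (y0 + i + 1) \<notin> S"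
        using indep_ptD[OF S, of "x + 1" "y0 + i + 1" "x - 1" "y0 + i + 1"] by auto
      assume "p \<noteq> q"
      moreover have "p = pt (x + 1) (y0 + i + 1) \<or> p = pt (x - 1) (y0 + i + 1)"
        by (rule upper[OF p]) (use new in blast)
      moreover have "q = pt (x + 1) (y0 + i + 1) \<or> q = pt (x - 1) (y0 + i + 1)"
        by (rule upper[OF q]) (use new in blast)
      ultimately show False using nonadj p q by blast
    qed
  qed
  note filled = fill[OF S' cls_indep this]
  have "S - D - \<Union>(N ` cls r) \<union> cls r = cls r"
    by (rule indep_superset_cls[OF filled(1) _ r]) auto
  then have "reach (int (card (S - D)) - 1) (S - D) (cls r)" using filled(3) by simp
  moreover have "reach (int (card (S - D)) - 1) S (S - D)"
    using reach_remove[OF S DS] by (rule reach_weaken) (simp add: card)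
  ultimately show ?thesis unfolding card using reach_trans by blast
qed

section \<open>Sweeping by columns\<close>

lemma col_subset_cls: "col x \<subseteq> cls (x mod 3)"
  by (auto simp: col_def)

lemma col_E:
  assumes "v \<in> col x"
  obtains y where "v = pt x y" "even (x + y)"
  using assms by (auto simp: col_def)

lemma col_mod_row_E:
  assumes "v \<in> col x"
  obtains i where "v = pt x (y0 + i)" "even (x + (y0 + i))" "0 \<le> i" "i < 2 * int K"
    "i = (snd v - y0) mod (2 * int K)"
proof -
  obtain y where y: "v = pt x y" "even (x + y)" using assms by (rule col_E)
  define i where "i = (y - y0) mod (2 * int K)"
  have "0 \<le> i" "i < 2 * int K" using K2 by (auto simp: i_def)
  moreover have v: "v = pt x (y0 + i)" by (simp add: y i_def pt_mod_row)
  moreover have "even (x + (y0 + i))"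
  proof -
    have "pt x (y0 + i) \<in> V" using y v pt_in_V by metis
    then show ?thesis by simp
  qed
  moreover have "i = (snd v - y0) mod (2 * int K)" by (simp add: y rank_pt i_def)
  ultimately show thesis using that by blast
qed

text \<open>
  With the two columns on the left empty, a site \<open>(c, y)\<close> can have occupied
  neighbours only at \<open>(c + 2, y)\<close> and \<open>(c + 1, y \<plusminus> 1)\<close>. Going
  upwards, \<open>(c + 1, y - 1)\<close> has been cleared by the previous site of the column, and
  the two others are adjacent. Starting just above an empty site \<open>(c + 1, h)\<close> makes
  this true for the first site as well.
\<close>

lemma fill_col_from_hole:
  assumes S: "indep S" and e1: "S \<inter> col (c - 1) = {}" and e2: "S \<inter> col (c - 2) = {}"
    and h: "even (c + 1 + h)" "pt (c + 1) h \<notin> S"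
  shows "indep (S - \<Union>(N ` col c) \<union> col c)"
    "card S \<le> card (S - \<Union>(N ` col c) \<union> col c)"
    "reach (int (card S) - 1) S (S - \<Union>(N ` col c) \<union> col c)"
proof -
  define rank where "rank v = nat ((snd v - (h + 1)) mod (2 * int K))" for v :: site
  have T: "indep (col c)" using cls_indep col_subset_cls by (rule indep_subset)
  have empty: "pt (c - 1) y \<notin> S" "pt (c - 2) y \<notin> S" for y
    using e1 e2 indep_pt_even[OF S] pt_in_colI[of "c - 1" y] pt_in_colI[of "c - 2" y] by blast+
  have "swap_order rank S (col c)"
    unfolding swap_order_def
  proof (intro ballI impI)
    fix v p q
    assume v: "v \<in> col c" and p: "p \<in> N v \<inter> S" and q: "q \<in> N v \<inter> S"
      and new: "\<forall>u\<in>col c. rank u < rank v \<longrightarrow> p \<notin> N u \<and> q \<notin> N u"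
    obtain i where i: "v = pt c (h + 1 + i)" "even (c + (h + 1 + i))" "0 \<le> i" "i < 2 * int K"
      "i = (snd v - (h + 1)) mod (2 * int K)"
      using v by (rule col_mod_row_E)
    have rank_v: "rank v = nat i" using i(5) by (simp add: rank_def)
    have right: "p = pt (c + 2) (h + 1 + i) \<or> p = pt (c + 1) (h + 1 + i + 1)"
      if p: "p \<in> N v \<inter> S" and new: "\<forall>u\<in>col c. rank u < rank v \<longrightarrow> p \<notin> N u" for p
    proof (rule ccontr)
      assume "\<not> ?thesis"
      then have below: "p = pt (c + 1) (h + i)" using p empty unfolding i(1) neighbors_pt by auto
      show False
      proof (cases "i = 0")
        case True
        then show False using below p h by simp
      next
        case False
        have "even i" using i(2) h(1) by presburger
        with False i(3) have "i \<ge> 2" by presburger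
        define u where "u = pt c (h + 1 + (i - 2))"
        have "rank u = nat (i - 2)"
          using \<open>i \<ge> 2\<close> i(4) by (simp add: rank_def u_def rank_pt)
        then have "rank u < rank v" using rank_v \<open>i \<ge> 2\<close> by simp
        moreover have "even (c + (h + 1 + (i - 2)))" using i(2) by presburger
        then have "u \<in> col c" unfolding u_def by (rule pt_in_colI)
        ultimately have "p \<notin> N u" using new by blast
        moreover have "p \<in> N u" unfolding below u_def by (rule neighbors_ptI) simp
        ultimately show False by blast
      qed
    qed
    have nonadj: "pt (c + 2) (h + 1 + i) \<notin> S \<or> pt (c + 1) (h + 1 + i + 1) \<notin> S"
      using indep_ptD[OF S, of "c + 2" "h + 1 + i" "c + 1" "h + 1 + i + 1"] by auto
    have "p = pt (c + 2) (h + 1 + i) \<or> p = pt (c + 1) (h + 1 + i + 1)"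
      by (rule right[OF p]) (use new in blast)
    moreover have "q = pt (c + 2) (h + 1 + i) \<or> q = pt (c + 1) (h + 1 + i + 1)"
      by (rule right[OF q]) (use new in blast)
    ultimately show "p = q" using nonadj p q by blast
  qed
  from fill[OF S T this] show "indep (S - \<Union>(N ` col c) \<union> col c)"
    "card S \<le> card (S - \<Union>(N ` col c) \<union> col c)"
    "reach (int (card S) - 1) S (S - \<Union>(N ` col c) \<union> col c)" .
qed

text \<open>
  If column \<open>c + 1\<close> is full, one of its particles is removed to create the hole,
  which is why a second particle may be missing on the way. No particle is lost in the end, since
  the particles of the full column are exchanged for those of column \<open>c\<close>, one for
  one.
\<close>

lemma fill_col:
  assumes S: "indep S" and e1: "S \<inter> col (c - 1) = {}" and e2: "S \<inter> col (c - 2) = {}"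
  shows "indep (S - \<Union>(N ` col c) \<union> col c)"
    "card S \<le> card (S - \<Union>(N ` col c) \<union> col c)"
    "reach (int (card S) - (if col (c + 1) \<subseteq> S then 2 else 1)) S (S - \<Union>(N ` col c) \<union> col c)"
proof -
  let ?F = "S - \<Union>(N ` col c) \<union> col c"
  have "indep ?F \<and> card S \<le> card ?F \<and> reach (int (card S) - (if col (c + 1) \<subseteq> S then 2 else 1)) S ?F"
  proof (cases "col (c + 1) \<subseteq> S")
    case False
    then obtain v where "v \<in> col (c + 1)" "v \<notin> S" by blast
    then obtain h where "even (c + 1 + h)" "pt (c + 1) h \<notin> S" by (metis col_E)
    note filled = fill_col_from_hole[OF S e1 e2 this]
    show ?thesis using filled False by (intro conjI) (simp_all only: if_False)
  next
    case True
    have mid: "pt (c + 1) y \<in> S" if "even (c + 1 + y)" for y using True pt_in_colI[OF that] by blast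
    have empty: "pt (c - 1) y \<notin> S" "pt (c - 2) y \<notin> S" for y
      using e1 e2 indep_pt_even[OF S] pt_in_colI[of "c - 1" y] pt_in_colI[of "c - 2" y] by blast+
    define h where "h = c + 1"
    define x where "x = pt (c + 1) h"
    have h: "even (c + 1 + h)" by (simp add: h_def)
    have x: "x \<in> S" using mid[OF h] by (simp add: x_def)
    have xN: "x \<in> N (pt c (h - 1))" unfolding x_def by (rule neighbors_ptI) simp
    moreover have "pt c (h - 1) \<in> col c" using h by (intro pt_in_colI) presburger
    ultimately have F: "S - {x} - \<Union>(N ` col c) \<union> col c = ?F" by blast
    have S': "indep (S - {x})" using S by (rule indep_subset) auto
    have card': "int (card (S - {x})) = int (card S) - 1" using int_card_Diff[OF S, of "{x}"] x by simp
    have "(S - {x}) \<inter> col (c - 1) = {}" "(S - {x}) \<inter> col (c - 2) = {}" "pt (c + 1) h \<notin> S - {x}"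
      using e1 e2 by (auto simp: x_def)
    note filled = fill_col_from_hole[OF S' this(1,2) h this(3), unfolded F]
    have "reach (int (card S) - 1) S (S - {x})"
      using reach_remove[OF S, of "{x}"] x by simp
    then have "reach (int (card S) - 2) S (S - {x})" by (rule reach_weaken) simp
    then have reach: "reach (int (card S) - 2) S ?F"
      using filled(3) unfolding card' by (elim reach_trans) simp
    define up where "up v = pt (fst v + 1) (snd v + 1)" for v
    define A where "A = S \<inter> \<Union>(N ` col c)"
    have "A \<subseteq> up ` col c"
    proof
      fix a assume a: "a \<in> A"
      then obtain v where v: "v \<in> col c" "a \<in> N v" "a \<in> S" unfolding A_def by blast
      then obtain y where y: "even (c + y)" "a \<in> N (pt c y)" "a \<in> S" by (metis col_E)
      have up: "up (pt c z) = pt (c + 1) (z + 1)" for z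
        by (simp add: up_def pt_def mod_simps)
      have "pt (c + 2) y \<notin> S"
        using mid[of "y + 1"] y(1) indep_ptD[OF S, of "c + 2" y "c + 1" "y + 1"] by auto
      then have "a = pt (c + 1) (y + 1) \<or> a = pt (c + 1) (y - 2 + 1)"
        using y(2,3) empty unfolding neighbors_pt by auto
      moreover have "pt c y \<in> col c" "pt c (y - 2) \<in> col c" using y(1) by (intro pt_in_colI; simp)+
      ultimately show "a \<in> up ` col c"
        using imageI[of "pt c y" "col c" up] imageI[of "pt c (y - 2)" "col c" up] unfolding up by blast
    qed
    moreover have fin: "finite (col c)"
      using col_subset_cls cls_subset_V finite_V by (meson finite_subset)
    ultimately have "card A \<le> card (col c)"
      by (meson card_image_le card_mono finite_imageI order_trans)
    moreover have "int (card (S - A)) = int (card S) - int (card A)"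
      by (rule int_card_Diff[OF S]) (auto simp: A_def)
    moreover have "card ?F = card (S - A) + card (col c)"
    proof -
      have "pt c y \<notin> S" if "even (c + y)" for y
        using mid[of "y + 1"] that indep_ptD[OF S, of c y "c + 1" "y + 1"] by auto
      then have "(S - A) \<inter> col c = {}" by (metis Diff_disjoint Diff_iff col_E disjoint_iff)
      moreover have "?F = (S - A) \<union> col c" unfolding A_def by blast
      ultimately show ?thesis using fin indep_finite[OF S] by (simp add: card_Un_disjoint)
    qed
    ultimately have "card S \<le> card ?F" by linarith
    then show ?thesis using filled(1) reach True by (intro conjI) (simp_all only: if_True)
  qed
  then show "indep ?F" "card S \<le> card ?F"
    "reach (int (card S) - (if col (c + 1) \<subseteq> S then 2 else 1)) S ?F" by auto
qed

text \<open>
  Columns \<open>X\<close>, \<open>X + 3\<close>, \<open>X + 6\<close>, ... are filled in turn.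
  The two columns to the left of the next one are empty by hypothesis at the start, and later
  because the previously filled column excludes particles from them. A column \<open>c + 1\<close>
  of the class after the target's is full at its turn only if it was full from the start, since
  the sweep adds only particles of the target class.
\<close>

lemma vertical_sweep:
  assumes S: "indep S" and e1: "S \<inter> col (X - 1) = {}" and e2: "S \<inter> col (X - 2) = {}"
    and w: "w = (if \<exists>c. c mod 3 = X mod 3 \<and> col (c + 1) \<subseteq> S then 2 else 1)"
  shows "reach (int (card S) - w) S (cls (X mod 3))"
proof -
  define r where "r = X mod 3"
  have r: "r \<in> {0, 1, 2}" unfolding r_def by auto
  have "\<exists>F. indep F \<and> card S \<le> card F \<and> reach (int (card S) - w) S F
      \<and> (\<forall>i<j. col (X + 3 * int i) \<subseteq> F) \<and> F \<subseteq> S \<union> cls r \<and> (j = 0 \<longrightarrow> F = S)" for j :: nat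
  proof (induction j)
    case 0
    show ?case using S by (intro exI[of _ S]) auto
  next
    case (Suc j)
    then obtain F where F: "indep F" "card S \<le> card F" "reach (int (card S) - w) S F"
      "\<And>i. i < j \<Longrightarrow> col (X + 3 * int i) \<subseteq> F" "F \<subseteq> S \<union> cls r" "j = 0 \<longrightarrow> F = S"
      by blast
    define c where "c = X + 3 * int j"
    have c_mod: "c mod 3 = r" by (simp add: c_def r_def)
    have empty: "F \<inter> col (c - 1) = {} \<and> F \<inter> col (c - 2) = {}"
    proof (cases j)
      case 0
      then show ?thesis using F(6) e1 e2 by (simp add: c_def)
    next
      case (Suc k)
      then have "col (c - 3) \<subseteq> F" using F(4)[of k] by (simp add: c_def)
      then have full: "pt (c - 3) y \<in> F" if "even (c - 3 + y)" for y using pt_in_colI[OF that] by blast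
      have "pt (c - 1) y \<notin> F" if "even (c - 1 + y)" for y
        using full[of y] that indep_ptD[OF F(1), of "c - 1" y "c - 3" y] by auto
      moreover have "pt (c - 2) y \<notin> F" if "even (c - 2 + y)" for y
        using full[of "y + 1"] that indep_ptD[OF F(1), of "c - 2" y "c - 3" "y + 1"] by auto
      ultimately show ?thesis by (metis col_E disjoint_iff)
    qed
    define F' where "F' = F - \<Union>(N ` col c) \<union> col c"
    have F': "indep F'" "card F \<le> card F'"
      "reach (int (card F) - (if col (c + 1) \<subseteq> F then 2 else 1)) F F'"
      unfolding F'_def using fill_col[OF F(1)] empty by blast+
    have "(if col (c + 1) \<subseteq> F then 2 else 1) \<le> w"
    proof (cases "col (c + 1) \<subseteq> F")
      case True
      have "(c + 1) mod 3 \<noteq> c mod 3" by presburger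
      then have "cls ((c + 1) mod 3) \<inter> cls r = {}" using c_mod by (auto simp: sites_class_def)
      then have "col (c + 1) \<inter> cls r = {}" using col_subset_cls[of "c + 1"] by blast
      with True F(5) have "col (c + 1) \<subseteq> S" by blast
      then show ?thesis using w c_mod by (auto simp: r_def)
    qed (simp add: w)
    then have "reach (int (card S) - w) F F'"
      using F(2) by (intro reach_weaken[OF F'(3)]) auto
    then have "reach (int (card S) - w) S F'" using F(3) reach_trans by blast
    moreover have "col (X + 3 * int i) \<subseteq> F'" if "i < Suc j" for i
    proof (cases "i = j")
      case True
      then show ?thesis by (simp add: F'_def c_def)
    next
      case False
      \<comment> \<open>Columns that have been filled stay full: sites of one class are never adjacent.\<close>
      have "col (X + 3 * int i) \<subseteq> cls r" using col_subset_cls[of "X + 3 * int i"] by (simp add: r_def)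
      moreover have "col c \<subseteq> cls r" using col_subset_cls[of c] by (simp add: c_mod)
      ultimately have "col (X + 3 * int i) \<inter> \<Union>(N ` col c) = {}"
        using cls_indep[of r] unfolding indep_def by blast
      then show ?thesis using F(4)[of i] False that by (auto simp: F'_def)
    qed
    moreover have "F' \<subseteq> S \<union> cls r"
      using F(5) col_subset_cls[of c] by (auto simp: F'_def c_mod)
    ultimately show ?case using F' F(2) by (intro exI[of _ F']) auto
  qed
  from this[of "2 * L"] obtain F where F: "indep F" "reach (int (card S) - w) S F"
    "\<And>i. i < 2 * L \<Longrightarrow> col (X + 3 * int i) \<subseteq> F" by blast
  have "cls r \<subseteq> F"
  proof
    fix v assume v: "v \<in> cls r"
    then obtain x y where xy: "v = pt x y" using cls_subset_V V_pt_E by (meson subsetD)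
    with v have x: "even (x + y)" "x mod 3 = X mod 3" by (auto simp: r_def)
    then obtain k where k: "x = X + 3 * k" by (metis add.commute diff_add_cancel dvdE mod_eq_dvd_iff)
    define i where "i = nat (k mod (2 * int L))"
    have i: "int i = k mod (2 * int L)" using L1 by (simp add: i_def)
    then have "i < 2 * L" using L1 by (simp add: i_def nat_less_iff)
    have "3 * int i = (3 * k) mod (6 * int L)" unfolding i using mult_mod_right[of 3 k "2 * int L"] by simp
    then have "v = pt (X + 3 * int i) y" by (simp add: xy k pt_eq_iff mod_simps)
    moreover have "even (X + 3 * int i + y)"
      using calculation v cls_subset_V pt_in_V by (metis subsetD)
    ultimately show "v \<in> F" using F(3)[OF \<open>i < 2 * L\<close>] pt_in_colI by blast
  qed
  with F show ?thesis using indep_superset_cls[OF F(1) _ r] by (simp add: r_def)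
qed

section \<open>Paths to and between the three classes\<close>

lemma card_in_two_rows:
  assumes "D \<subseteq> V" and D: "D \<subseteq> row y \<union> row (y + 1)"
  shows "int (card D) = row_count D y + row_count D (y + 1)"
proof -
  have zero: "row_count D u = 0"
    if "u mod (2 * int K) \<noteq> y mod (2 * int K)" "u mod (2 * int K) \<noteq> (y + 1) mod (2 * int K)" for u
  proof -
    have "pt x u \<notin> D" for x using D that by (auto simp: row_def pt_eq_iff)
    then show ?thesis by (simp add: row_count_def occ_def)
  qed
  have "row_count D (y + 2 * int j) + row_count D (y + 2 * int j + 1) = 0" if "0 < j" "j < K" for j
  proof -
    have "row_count D (y + 2 * int j + i) = 0" if "i \<in> {0, 1}" for i
      using that \<open>0 < j\<close> \<open>j < K\<close> by (intro zero mod_neq_of_lt) auto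
    from this[of 0] this[of 1] show ?thesis by simp
  qed
  then show ?thesis
    unfolding card_eq_sum_rows[OF assms(1), of y] using K2 by (subst sum_only_first) auto
qed

lemma card_in_three_cols:
  assumes "D \<subseteq> V" and D: "D \<subseteq> col x \<union> col (x + 1) \<union> col (x + 2)"
  shows "int (card D) = col_count D x + col_count D (x + 1) + col_count D (x + 2)"
proof -
  have zero: "col_count D c = 0"
    if "c mod (6 * int L) \<noteq> x mod (6 * int L)" "c mod (6 * int L) \<noteq> (x + 1) mod (6 * int L)"
      "c mod (6 * int L) \<noteq> (x + 2) mod (6 * int L)" for c
  proof -
    have "pt c y \<notin> D" for y using D that by (auto simp: col_def pt_eq_iff)
    then show ?thesis by (simp add: col_count_def occ_def)
  qed
  have "col_count D (x + 3 * int j) + col_count D (x + 3 * int j + 1) + col_count D (x + 3 * int j + 2) = 0"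
    if "0 < j" "j < 2 * L" for j
  proof -
    have "col_count D (x + 3 * int j + i) = 0" if "i \<in> {0, 1, 2}" for i
      using that \<open>0 < j\<close> \<open>j < 2 * L\<close> by (intro zero mod_neq_of_lt) auto
    from this[of 0] this[of 1] this[of 2] show ?thesis by simp
  qed
  then show ?thesis
    unfolding card_eq_sum_cols[OF assms(1), of x] using L1 by (subst sum_only_first) auto
qed

lemma vertical_sweep_clearing:
  assumes S: "indep S" and D: "D = S \<inter> (col (X - 2) \<union> col (X - 1))"
    and none: "\<nexists>c. c mod 3 = X mod 3 \<and> col (c + 1) \<subseteq> S"
  shows "reach (int (card S) - int (card D) - 1) S (cls (X mod 3))"
proof -
  have DS: "D \<subseteq> S" by (auto simp: D)
  have card: "int (card (S - D)) = int (card S) - int (card D)" by (rule int_card_Diff[OF S DS])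
  have ind: "indep (S - D)" using S by (rule indep_subset) auto
  have "reach (int (card (S - D)) - 1) (S - D) (cls (X mod 3))"
    using none by (intro vertical_sweep[OF ind]) (auto simp: D)
  moreover have "reach (int (card (S - D)) - 1) S (S - D)"
    using reach_remove[OF S DS] by (rule reach_weaken) (simp add: card)
  ultimately show ?thesis unfolding card using reach_trans by blast
qed

text \<open>
  If removing all classes but 0 from rows \<open>-1\<close> and \<open>0\<close> costs
  \<open>2L\<close> particles, then these rows are full of a single class \<open>t\<close>, and
  sweeping towards \<open>t\<close> costs no preparation at all.
\<close>

lemma reach_stable_rows:
  assumes S: "indep S"
  shows "\<exists>r\<in>{0, 1, 2}. reach (int (card S) - 2 * int L) S (cls r)"
proof -
  define D where "D r = (S - cls r) \<inter> (row (- 1) \<union> row 0)" for r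
  have indD: "indep (D r)" for r using S by (rule indep_subset) (auto simp: D_def)
  have DV: "D r \<subseteq> V" for r using indD by (simp add: indep_def)
  have cardD: "int (card (D r)) = row_count (D r) (- 1) + row_count (D r) (- 1 + 1)" for r
    by (rule card_in_two_rows[OF DV]) (auto simp: D_def)
  have "\<exists>r\<in>{0, 1, 2}. int (card (D r)) \<le> 2 * int L - 1"
  proof (rule ccontr)
    assume large: "\<not> ?thesis"
    then have "row_count (D 0) (- 1) + row_count (D 0) (- 1 + 1) \<ge> 2 * int L" using cardD[of 0] by auto
    from pair_of_rows_le(2)[OF indD this]
    obtain t where t: "t \<in> {0, 1, 2}" "full_row (D 0) (- 1) t" "full_row (D 0) 0 t" by auto
    then have full: "full_row S (- 1) t" "full_row S 0 t" by (auto simp: D_def full_row_def)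
    have "D t = {}"
    proof (rule ccontr)
      assume "D t \<noteq> {}"
      then obtain v where v: "v \<in> S" "v \<notin> cls t" "v \<in> row (- 1) \<union> row 0" by (auto simp: D_def)
      then obtain x u where xu: "v = pt x u" "even (x + u)" "u = - 1 \<or> u = 0" by (auto simp: row_def)
      then have "x mod 3 = t"
        using full_row_class[OF S full(2) t(1), of x u] v(1) by auto
      then show False using v(2) xu by simp
    qed
    then show False using large t(1) L1 by auto
  qed
  then obtain r where r: "r \<in> {0, 1, 2}" "int (card (D r)) \<le> 2 * int L - 1" by blast
  have "reach (int (card S) - int (card (D r)) - 1) S (cls r)"
    by (rule horizontal_sweep[OF S r(1), of _ 0]) (simp add: D_def)
  then have "reach (int (card S) - 2 * int L) S (cls r)" by (rule reach_weaken) (use r in simp)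
  then show ?thesis using r(1) by (rule bexI)
qed

text \<open>
  Apply \<open>window_le\<close> to the particles in columns \<open>x\<close> and \<open>x +
  1\<close> only. If there were \<open>K\<close> of them, both the window starting at \<open>x -
  1\<close> and the one starting at \<open>x\<close> would be full, and whichever of the two
  columns contains a particle is the middle of one of these windows, hence full.
\<close>

lemma few_in_two_cols:
  assumes S: "indep S" and none: "\<nexists>x. col x \<subseteq> S"
  shows "int (card (S \<inter> (col x \<union> col (x + 1)))) \<le> int K - 1"
proof (rule ccontr)
  define D where "D = S \<inter> (col x \<union> col (x + 1))"
  assume "\<not> ?thesis"
  then have card: "int (card D) \<ge> int K" by (simp add: D_def)
  have indD: "indep D" using S by (rule indep_subset) (auto simp: D_def)
  then have DV: "D \<subseteq> V" by (simp add: indep_def)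
  have spread: "col (c + 1) \<subseteq> S" if D: "D \<subseteq> col c \<union> col (c + 1) \<union> col (c + 2)" and u: "pt (c + 1) u \<in> D" for c u
  proof
    fix v assume "v \<in> col (c + 1)"
    then obtain y where y: "v = pt (c + 1) y" "even (c + 1 + y)" by (rule col_E)
    have "even (c + 1 + u)" by (rule indep_pt_even[OF indD u])
    then have "even (u + y)" using y(2) by presburger
    then have "v \<in> D"
      unfolding y(1) using window_le(2)[OF indD _ u] card card_in_three_cols[OF DV D] by simp
    then show "v \<in> S" by (simp add: D_def)
  qed
  have "D \<noteq> {}" using card K2 by auto
  then obtain v where v: "v \<in> D" "v \<in> col x \<or> v \<in> col (x + 1)" by (auto simp: D_def)
  then obtain u where "pt x u \<in> D \<or> pt (x + 1) u \<in> D" by (metis col_E)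
  moreover have "D \<subseteq> col x \<union> col (x + 1) \<union> col (x + 2)" "D \<subseteq> col (x - 1) \<union> col (x - 1 + 1) \<union> col (x - 1 + 2)"
  proof -
    have eqs: "x - 1 + 1 = x" "x - 1 + 2 = x + 1" by simp_all
    then show "D \<subseteq> col x \<union> col (x + 1) \<union> col (x + 2)"
      "D \<subseteq> col (x - 1) \<union> col (x - 1 + 1) \<union> col (x - 1 + 2)"
      unfolding D_def eqs by blast+
  qed
  ultimately show False using spread[of x u] spread[of "x - 1" u] none by auto
qed

text \<open>
  A full column forces the two columns on its left to be empty, so sweeping from it towards its
  own class needs no preparation; at most two particles are missing then, and \<open>2 \<le>
  K\<close>. Without any full column the preparation costs at most \<open>K - 1\<close>.
\<close>

lemma reach_stable_cols:
  assumes S: "indep S"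
  shows "\<exists>r\<in>{0, 1, 2}. reach (int (card S) - int K) S (cls r)"
proof (cases "\<exists>X. col X \<subseteq> S")
  case True
  then obtain X where X: "col X \<subseteq> S" by blast
  have full: "pt X y \<in> S" if "even (X + y)" for y using X pt_in_colI[OF that] by blast
  have "pt (X - 1) y \<notin> S" if "even (X - 1 + y)" for y
    using full[of "y + 1"] that indep_ptD[OF S, of "X - 1" y X "y + 1"] by auto
  then have e1: "S \<inter> col (X - 1) = {}" by (metis col_E disjoint_iff)
  have "pt (X - 2) y \<notin> S" if "even (X - 2 + y)" for y
    using full[of y] that indep_ptD[OF S, of "X - 2" y X y] by auto
  then have e2: "S \<inter> col (X - 2) = {}" by (metis col_E disjoint_iff)
  from vertical_sweep[OF S e1 e2 refl] have "reach (int (card S) - int K) S (cls (X mod 3))"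
    by (rule reach_weaken) (use K2 in auto)
  moreover have "X mod 3 \<in> {0, 1, 2}" by auto
  ultimately show ?thesis by (rule bexI)
next
  case False
  have "int (card (S \<inter> (col (2 - 2) \<union> col (2 - 1)))) \<le> int K - 1"
    using few_in_two_cols[OF S False, of 0] by simp
  moreover have "reach (int (card S) - int (card (S \<inter> (col (2 - 2) \<union> col (2 - 1)))) - 1) S (cls (2 mod 3))"
    by (rule vertical_sweep_clearing[OF S refl]) (use False in blast)
  ultimately have "reach (int (card S) - int K) S (cls (2 mod 3))" by (elim reach_weaken) simp
  then show ?thesis by auto
qed

lemma reach_stable:
  assumes "indep S"
  shows "\<exists>r\<in>{0, 1, 2}. reach (int (card S) - int (min K (2 * L))) S (cls r)"
proof (cases "K \<le> 2 * L")
  case True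
  then show ?thesis using reach_stable_cols[OF assms] by (simp only: min_absorb1)
next
  case False
  then have "int (min K (2 * L)) = 2 * int L" by simp
  then show ?thesis using reach_stable_rows[OF assms] by (simp only:)
qed

text \<open>
  Rows or columns are swept, whichever is cheaper to prepare. In class \<open>r\<close> the
  columns of class \<open>r + 2\<close> are empty, so no full column is in the way of the sweep to
  the right towards class \<open>r + 1\<close>. The sweep to the right towards class \<open>r +
  2\<close> would meet full columns; that pair of classes is joined by reversed paths.
\<close>

lemma reach_next_class:
  assumes r: "r \<in> {0, 1, 2}"
  shows "reach (2 * int K * int L - int (min K (2 * L)) - 1) (cls r) (cls ((r + 1) mod 3))"
proof (cases "K \<le> 2 * L")
  case True
  define D where "D = cls r \<inter> (col (r + 1 - 2) \<union> col (r + 1 - 1))"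
  have indD: "indep D" using cls_indep by (rule indep_subset) (auto simp: D_def)
  then have DV: "D \<subseteq> V" by (simp add: indep_def)
  have "D \<subseteq> col (r - 1) \<union> col (r - 1 + 1) \<union> col (r - 1 + 2)" by (auto simp: D_def)
  then have "int (card D) \<le> int K"
    using card_in_three_cols[OF DV] window_le(1)[OF indD] by metis
  moreover have "\<nexists>c. c mod 3 = (r + 1) mod 3 \<and> col (c + 1) \<subseteq> cls r"
  proof
    assume "\<exists>c. c mod 3 = (r + 1) mod 3 \<and> col (c + 1) \<subseteq> cls r"
    then obtain c where c: "c mod 3 = (r + 1) mod 3" "col (c + 1) \<subseteq> cls r" by blast
    have "pt (c + 1) (c + 1) \<in> col (c + 1)" by (rule pt_in_colI) simp
    with c(2) have "(c + 1) mod 3 = r" by auto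
    with c(1) show False by presburger
  qed
  from vertical_sweep_clearing[OF cls_indep D_def this]
  have "reach (int (card (cls r)) - int (card D) - 1) (cls r) (cls ((r + 1) mod 3))" .
  ultimately show ?thesis using True card_cls[OF r] by (elim reach_weaken) (simp add: min_def)
next
  case False
  define s where "s = (r + 1) mod 3"
  have s: "s \<in> {0, 1, 2}" unfolding s_def by auto
  define D where "D = (cls r - cls s) \<inter> (row (0 - 1) \<union> row 0)"
  have indD: "indep D" using cls_indep by (rule indep_subset) (auto simp: D_def)
  then have DV: "D \<subseteq> V" by (simp add: indep_def)
  have "int (card D) = row_count D (- 1) + row_count D (- 1 + 1)"
    by (rule card_in_two_rows[OF DV]) (auto simp: D_def)
  then have "int (card D) \<le> 2 * int L" using pair_of_rows_le(1)[OF indD, of "- 1"] by simp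
  then show ?thesis
    using False card_cls[OF r] horizontal_sweep[OF cls_indep s D_def]
    unfolding s_def[symmetric] by (elim reach_weaken) (simp add: min_def)
qed

lemma reach_between_classes:
  assumes "r \<in> {0, 1, 2}" "s \<in> {0, 1, 2}"
  shows "reach (2 * int K * int L - int (min K (2 * L)) - 1) (cls r) (cls s)"
proof -
  let ?h = "2 * int K * int L - int (min K (2 * L)) - 1"
  have "reach ?h (cls 0) (cls 1)" "reach ?h (cls 1) (cls 2)"
    using reach_next_class[of 0] reach_next_class[of 1] by auto
  then have "reach ?h (cls 0) (cls r)" "reach ?h (cls 0) (cls s)"
    using assms reach_trans by auto
  then show ?thesis using reach_sym reach_trans by blast
qed

section \<open>The bottleneck between two classes\<close>

definition strip :: "site set \<Rightarrow> int \<Rightarrow> bool" where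
  "strip S r \<longleftrightarrow> (\<exists>y. full_row S y r \<and> full_row S (y + 1) r)"

lemma strip_mono: "strip S r \<Longrightarrow> S \<subseteq> T \<Longrightarrow> strip T r"
  unfolding strip_def using full_row_mono by blast

text \<open>
  Each of the three residues of \<open>x\<close> gives a partition of the torus into
  \<open>2L\<close> windows of three columns, so there is a full window with middle column in any
  prescribed class.
\<close>

lemma middle_class_window:
  assumes "indep S" "int (card S) > 2 * int K * int L - 2 * int L" "r \<in> {0, 1, 2}"
  obtains x where "(x + 1) mod 3 = r"
    "\<And>u u'. pt (x + 1) u \<in> S \<Longrightarrow> even (u + u') \<Longrightarrow> pt (x + 1) u' \<in> S"
proof -
  obtain x where x: "x mod 3 = (r - 1) mod 3"
    "col_count S x + col_count S (x + 1) + col_count S (x + 2) \<ge> int K"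
    using exists_full_window[OF assms(1,2), of "r - 1"] by blast
  have "(x + 1) mod 3 = r" using x(1) assms(3) by auto presburger+
  then show thesis using that window_le(2)[OF assms(1) x(2)] by blast
qed

text \<open>
  Take a full window with middle column of class \<open>r\<close>. The strip of class
  \<open>r\<close> occupies a site of this column, so the whole column is full. It therefore has a
  particle in a row of the other strip.
\<close>

lemma strip_unique:
  assumes S: "indep S" and card: "int (card S) > 2 * int K * int L - 2 * int L"
    and strips: "strip S r" "strip S s" and rs: "r \<in> {0, 1, 2}" "s \<in> {0, 1, 2}"
  shows "r = s"
proof -
  obtain x where x: "(x + 1) mod 3 = r"
    "\<And>u u'. pt (x + 1) u \<in> S \<Longrightarrow> even (u + u') \<Longrightarrow> pt (x + 1) u' \<in> S"
    using middle_class_window[OF S card rs(1)] by blast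
  have row: "\<exists>u. even (x + 1 + u) \<and> full_row S u t" if strip: "strip S t" for t
  proof -
    obtain y where "full_row S y t" "full_row S (y + 1) t" using strip by (auto simp: strip_def)
    moreover have "even (x + 1 + y) \<or> even (x + 1 + (y + 1))" by presburger
    ultimately show ?thesis by blast
  qed
  obtain u where u: "even (x + 1 + u)" "full_row S u r" using row[OF strips(1)] by blast
  obtain u' where u': "even (x + 1 + u')" "full_row S u' s" using row[OF strips(2)] by blast
  have "pt (x + 1) u \<in> S" using u x(1) by (auto simp: full_row_def)
  moreover have "even (u + u')" using u(1) u'(1) by presburger
  ultimately have "pt (x + 1) u' \<in> S" by (rule x(2))
  then show ?thesis using full_row_class[OF S u'(2) rs(2)] x(1) by auto
qed

text \<open>
  When all pairs of adjacent rows lack exactly one particle, the new particle completes both pairs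
  that contain its row \<open>b\<close>. Row \<open>b + 1\<close> is then full of class
  \<open>r\<close>, and it was so before \<open>v\<close> was added.
\<close>

lemma strip_created:
  assumes ind: "indep (insert v S)" and v: "v \<notin> S" and r: "r \<in> {0, 1, 2}"
    and strips: "strip (insert v S) r" "\<not> strip S r"
    and pairs: "\<And>y. row_count S y + row_count S (y + 1) = 2 * int L - 1"
  obtains a b where "v = pt a b" "full_row (insert v S) b r" "full_row S (b + 1) r"
proof -
  have "v \<in> V" using ind by (auto simp: indep_def)
  then obtain a b where ab: "v = pt a b" by (rule V_pt_E)
  obtain y where y: "full_row (insert v S) y r" "full_row (insert v S) (y + 1) r"
    using strips(1) by (auto simp: strip_def)
  have "y mod (2 * int K) = b mod (2 * int K) \<or> (y + 1) mod (2 * int K) = b mod (2 * int K)"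
    using strips(2) y full_row_insert unfolding ab strip_def by blast
  then have b: "full_row (insert v S) b r" using y full_row_periodic by blast
  have "row_count S (b + 1) \<le> row_count (insert v S) (b + 1)" by (rule row_count_mono) blast
  moreover have "row_count (insert v S) b = row_count S b + 1"
    using row_count_insert v unfolding ab by blast
  ultimately have "row_count (insert v S) b + row_count (insert v S) (b + 1) \<ge> 2 * int L"
    using pairs[of b] by linarith
  then obtain t where t: "t \<in> {0, 1, 2}" "full_row (insert v S) b t" "full_row (insert v S) (b + 1) t"
    using pair_of_rows_le(2)[OF ind] by blast
  have "t = r" by (rule full_row_unique[OF ind t(2) b t(1) r])
  moreover have "(b + 1) mod (2 * int K) \<noteq> b mod (2 * int K)"
    using K2 by (intro mod_neq_of_lt) auto
  ultimately have "full_row S (b + 1) r" using t(3) full_row_insert unfolding ab by blast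
  then show thesis using that ab b by blast
qed

text \<open>
  Suppose \<open>r \<noteq> s\<close>. By \<open>strip_unique\<close>, \<open>S\<close> has no
  strip, so each of the \<open>K\<close> disjoint pairs of rows lacks a particle, and then exactly
  one as only \<open>m \<le> K\<close> particles are missing in total. Hence \<open>v\<close> and
  \<open>w\<close> lie in rows \<open>b\<close> and \<open>b'\<close> such that rows \<open>b +
  1\<close> and \<open>b' + 1\<close> of \<open>S\<close> are full of class \<open>r\<close> and
  \<open>s\<close>, and the particle numbers of rows alternate, which gives \<open>b\<close> and
  \<open>b'\<close> the same parity. After adding \<open>v\<close> some column of class
  \<open>r\<close> is full. It meets row \<open>b'\<close> or row \<open>b' + 1\<close> in a site
  different from \<open>v\<close>, next to or inside a row full of class \<open>s\<close>.
\<close>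

lemma bottleneck_strips_agree:
  assumes indv: "indep (insert v S)" and indw: "indep (insert w S)" and vw: "v \<notin> S" "w \<notin> S"
    and card: "int (card S) = 2 * int K * int L - int (min K (2 * L))"
    and strips: "strip (insert v S) r" "strip (insert w S) s"
    and rs: "r \<in> {0, 1, 2}" "s \<in> {0, 1, 2}"
  shows "r = s"
proof (rule ccontr)
  assume "r \<noteq> s"
  have S: "indep S" using indv by (rule indep_subset) auto
  then have "S \<subseteq> V" "finite S" using indep_finite by (auto simp: indep_def)
  have cv: "int (card (insert v S)) > 2 * int K * int L - 2 * int L"
    and cw: "int (card (insert w S)) > 2 * int K * int L - 2 * int L"
    using card vw \<open>finite S\<close> by auto
  have no_strip: "\<not> strip S t" if t: "t \<in> {0, 1, 2}" for t
  proof
    assume "strip S t"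
    then have "strip (insert v S) t" "strip (insert w S) t" using strip_mono by blast+
    then have "t = r" "t = s"
      using strip_unique[OF indv cv _ strips(1) t rs(1)] strip_unique[OF indw cw _ strips(2) t rs(2)] by auto
    with \<open>r \<noteq> s\<close> show False by simp
  qed
  have pairs_le: "row_count S y + row_count S (y + 1) \<le> 2 * int L - 1" for y
    using pair_of_rows_le(2)[OF S, of y] no_strip unfolding strip_def by force
  have pairs: "row_count S y + row_count S (y + 1) = 2 * int L - 1" for y
  proof -
    have "(2 * int L - 1) * int K \<le> int (card S)" using card by (simp add: algebra_simps)
    then show ?thesis
      using sum_all_eq[of "{..<K}" "\<lambda>j. row_count S (y + 2 * int j) + row_count S (y + 2 * int j + 1)"
          "2 * int L - 1" 0] card_eq_sum_rows[OF \<open>S \<subseteq> V\<close>, of y] pairs_le K2 by simp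
  qed
  obtain a b where ab: "v = pt a b" "full_row (insert v S) b r" "full_row S (b + 1) r"
    using strip_created[OF indv vw(1) rs(1) strips(1) no_strip[OF rs(1)] pairs] by blast
  obtain a' b' where ab': "w = pt a' b'" "full_row (insert w S) b' s" "full_row S (b' + 1) s"
    using strip_created[OF indw vw(2) rs(2) strips(2) no_strip[OF rs(2)] pairs] by blast
  have parity: "even (b + b')"
  proof (rule ccontr)
    assume "odd (b + b')"
    then have "even (b' + 1 - b)" by simp
    then obtain k where "b' + 1 - b = 2 * k" by (elim evenE)
    then have k: "b' + 1 = b + 2 * k" by simp
    \<comment> \<open>Otherwise rows \<open>b + 1\<close> and \<open>b' + 1\<close> have opposite parity,
      and the two particle numbers that alternate are both at least \<open>L\<close>,
      although they add up to \<open>2L - 1\<close>.\<close>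
    have "row_count S (y + 2) = row_count S y" for y
    proof -
      have "row_count S (y + 1) + row_count S (y + 2) = 2 * int L - 1"
        using pairs[of "y + 1"] by (simp add: add.assoc)
      then show ?thesis using pairs[of y] by linarith
    qed
    then have "row_count S (b' + 1) = row_count S b" unfolding k by (rule periodic_mult)
    then show False
      using full_row_count[OF ab(3) rs(1)] full_row_count[OF ab'(3) rs(2)] pairs[of b] by linarith
  qed
  have rows_differ: "b' mod (2 * int K) \<noteq> b mod (2 * int K)"
  proof
    assume "b' mod (2 * int K) = b mod (2 * int K)"
    then have "(b' + 1) mod (2 * int K) = (b + 1) mod (2 * int K)" by (metis mod_add_left_eq)
    then have "full_row S (b + 1) s" using ab'(3) full_row_periodic by blast
    then show False using full_row_unique[OF S ab(3) _ rs] \<open>r \<noteq> s\<close> by blast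
  qed
  have rows_differ': "(b' + 1) mod (2 * int K) \<noteq> b mod (2 * int K)"
  proof
    assume "(b' + 1) mod (2 * int K) = b mod (2 * int K)"
    then have "even (b' + 1 - b)" by (metis dvd_mult_left mod_eq_dvd_iff)
    with parity show False by simp
  qed
  obtain x where x: "(x + 1) mod 3 = r"
    "\<And>u u'. pt (x + 1) u \<in> insert v S \<Longrightarrow> even (u + u') \<Longrightarrow> pt (x + 1) u' \<in> insert v S"
    using middle_class_window[OF indv cv rs(1)] by blast
  obtain u where u: "u = b' \<or> u = b' + 1" "pt (x + 1) u \<in> insert v S"
  proof (cases "even (x + 1 + b)")
    case True
    then have "pt (x + 1) b \<in> insert v S" using ab(2) x(1) by (auto simp: full_row_def)
    from x(2)[OF this parity] show thesis using that by blast
  next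
    case False
    then have "pt (x + 1) (b + 1) \<in> insert v S" using ab(3) x(1) by (auto simp: full_row_def)
    moreover have "even (b + 1 + (b' + 1))" using parity by simp
    ultimately have "pt (x + 1) (b' + 1) \<in> insert v S" by (rule x(2))
    then show thesis using that by blast
  qed
  have "u mod (2 * int K) \<noteq> b mod (2 * int K)" using u(1) rows_differ rows_differ' by auto
  then have "pt (x + 1) u \<in> S" using u(2) by (auto simp: ab(1) pt_eq_iff)
  then have "(x + 1) mod 3 = s" using full_row_class[OF S ab'(3) rs(2), of "x + 1" u] u(1) by auto
  with x(1) \<open>r \<noteq> s\<close> show False by simp
qed

text \<open>
  The invariant of a path that starts in class \<open>r\<close> and never exceeds deficit
  \<open>m\<close>. At deficit exactly \<open>m\<close> a strip need not exist any more, but the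
  class is remembered by the particle just removed: putting it back restores a strip.
\<close>

lemma reach_keeps_strip:
  assumes reach: "reach (2 * int K * int L - int (min K (2 * L))) (cls r) S" and r: "r \<in> {0, 1, 2}"
  shows "(int (card S) > 2 * int K * int L - int (min K (2 * L)) \<longrightarrow> strip S r)
    \<and> (int (card S) = 2 * int K * int L - int (min K (2 * L)) \<longrightarrow>
        (\<exists>v. v \<notin> S \<and> indep (insert v S) \<and> strip (insert v S) r))"
proof -
  define h where "h = 2 * int K * int L - int (min K (2 * L))"
  have h_ge: "h \<ge> 2 * int K * int L - int K" "h \<ge> 2 * int K * int L - 2 * int L"
    by (auto simp: h_def)
  have ex: "\<exists>t\<in>{0, 1, 2}. strip T t" if "indep T" "int (card T) > h" for T
    using exists_full_pair_of_rows[OF that(1)] that(2) h_ge(1) unfolding strip_def by fastforce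
  have unique: "t = r" if "indep T" "int (card T) > h" "strip T t" "strip T r" "t \<in> {0, 1, 2}" for T t
    using strip_unique[OF that(1) _ that(3,4,5) r] that(2) h_ge(2) by simp
  have "(move h)\<^sup>*\<^sup>* (cls r) S" using reach by (simp add: reach_def h_def)
  then have "(int (card S) > h \<longrightarrow> strip S r) \<and>
    (int (card S) = h \<longrightarrow> (\<exists>v. v \<notin> S \<and> indep (insert v S) \<and> strip (insert v S) r))"
  proof (induction rule: rtranclp_induct)
    case base
    have "h < int (card (cls r))" using card_cls[OF r] K2 L1 by (simp add: h_def)
    moreover have "strip (cls r) r" by (auto simp: strip_def full_row_def)
    ultimately show ?case by simp
  next
    case (step S T)
    then have ind: "indep S" "indep T" and h: "h \<le> int (card S)" "h \<le> int (card T)"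
      by (auto simp: move_def)
    have fin: "finite S" "finite T" using ind indep_finite by auto
    obtain v where "v \<notin> S \<and> T = insert v S \<or> v \<notin> T \<and> S = insert v T"
      using step.hyps(2) unfolding move_def by blast
    then show ?case
    proof (elim disjE conjE)
      assume v: "v \<notin> S" and T: "T = insert v S"
      have card: "int (card T) = int (card S) + 1" using v fin by (simp add: T)
      obtain t where t: "t \<in> {0, 1, 2}" "strip T t" using ex[OF ind(2)] card h by auto
      have "t = r"
      proof (cases "int (card S) = h")
        case True
        then obtain w where w: "w \<notin> S" "indep (insert w S)" "strip (insert w S) r"
          using step.IH by blast
        \<comment> \<open>\<open>w\<close> is the particle removed when the path came down to
          \<open>S\<close>, and \<open>v\<close> the one added now.\<close>
        from bottleneck_strips_agree[of v S w t r] show ?thesis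
          using ind t w v True r unfolding T h_def by blast
      next
        case False
        then have "strip S r" using step.IH h by auto
        then have "strip T r" by (rule strip_mono) (auto simp: T)
        then show ?thesis using unique[OF ind(2) _ t(2)] t(1) card h by auto
      qed
      then show ?thesis using t(2) card h by auto
    next
      assume v: "v \<notin> T" and S: "S = insert v T"
      have card: "int (card S) = int (card T) + 1" using v fin by (simp add: S)
      then have strip_S: "strip S r" using step.IH h by auto
      show ?thesis
      proof (intro conjI impI)
        assume "h < int (card T)"
        then obtain t where t: "t \<in> {0, 1, 2}" "strip T t" using ex[OF ind(2)] by blast
        have "strip S t" using t(2) by (rule strip_mono) (auto simp: S)
        then have "t = r" using unique[OF ind(1) _ _ strip_S t(1)] card h by auto
        then show "strip T r" using t by simp
      next
        show "\<exists>v. v \<notin> T \<and> indep (insert v T) \<and> strip (insert v T) r"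
          using v ind(1) strip_S unfolding S by blast
      qed
    qed
  qed
  then show ?thesis by (simp only: h_def)
qed

lemma no_reach_between_classes:
  assumes "reach (2 * int K * int L - int (min K (2 * L))) (cls r) (cls s)" "r \<in> {0, 1, 2}" "s \<in> {0, 1, 2}"
  shows "r = s"
proof -
  have card: "int (card (cls s)) > 2 * int K * int L - int (min K (2 * L))"
    using card_cls[OF assms(3)] K2 L1 by simp
  then have "strip (cls s) r" using reach_keeps_strip[OF assms(1,2)] by blast
  moreover have "strip (cls s) s" by (auto simp: strip_def full_row_def)
  ultimately show ?thesis using strip_unique[OF cls_indep _ _ _ assms(2,3), of s] card by simp
qed

section \<open>Configurations, paths and heights\<close>

abbreviation X :: "config set" where "X \<equiv> hc_configs K L"
abbreviation Q :: "config \<Rightarrow> config \<Rightarrow> real" where "Q \<equiv> hc_Q K L"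
abbreviation H :: "config \<Rightarrow> int" where "H \<equiv> hamiltonian K L"
abbreviation conf :: "site set \<Rightarrow> config" where "conf \<equiv> conf_of K L"

definition supp :: "config \<Rightarrow> site set" where
  "supp \<sigma> = {v \<in> V. \<sigma> v = 1}"

lemma conf_apply: "v \<in> V \<Longrightarrow> conf S v = (if v \<in> S then 1 else 0)"
  by (simp add: conf_of_def)

lemma supp_conf: "indep S \<Longrightarrow> supp (conf S) = S"
  by (auto simp: supp_def conf_apply indep_def split: if_splits)

lemma conf_in_X: "indep S \<Longrightarrow> conf S \<in> X"
  unfolding hc_configs_def
proof (intro CollectI conjI ballI)
  assume S: "indep S"
  show "conf S \<in> V \<rightarrow>\<^sub>E {0, 1}" by (auto simp: conf_of_def)
  fix v w assume vw: "v \<in> V" "w \<in> N v"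
  then have "w \<in> V" using neighbors_in_V by blast
  moreover have "\<not> (v \<in> S \<and> w \<in> S)" using S vw by (auto simp: indep_def)
  ultimately show "conf S v * conf S w = 0" using vw by (auto simp: conf_apply)
qed

lemma X_values: "\<sigma> \<in> X \<Longrightarrow> v \<in> V \<Longrightarrow> \<sigma> v = 0 \<or> \<sigma> v = 1"
  unfolding hc_configs_def by blast

lemma supp_indep:
  assumes "\<sigma> \<in> X"
  shows "indep (supp \<sigma>)"
  unfolding indep_def
proof (intro conjI ballI)
  show "supp \<sigma> \<subseteq> V" by (auto simp: supp_def)
  fix v assume "v \<in> supp \<sigma>"
  then have "v \<in> V" "\<sigma> v = 1" by (auto simp: supp_def)
  then have "\<sigma> w = 0" if "w \<in> N v" for w
    using assms that by (fastforce simp: hc_configs_def)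
  then show "N v \<inter> supp \<sigma> = {}" by (auto simp: supp_def)
qed

lemma conf_supp:
  assumes "\<sigma> \<in> X"
  shows "conf (supp \<sigma>) = \<sigma>"
proof
  fix v
  show "conf (supp \<sigma>) v = \<sigma> v"
  proof (cases "v \<in> V")
    case True
    then show ?thesis using X_values[OF assms True] by (auto simp: conf_apply supp_def)
  next
    case False
    have "\<sigma> \<in> V \<rightarrow>\<^sub>E {0, 1}" using assms by (simp add: hc_configs_def)
    then have "\<sigma> v = undefined" using False by (rule PiE_arb)
    then show ?thesis using False by (simp add: conf_of_def)
  qed
qed

lemma H_conf:
  assumes "indep S"
  shows "H (conf S) = - int (card S)"
proof -
  have "(\<Sum>v\<in>V. conf S v) = (\<Sum>v\<in>V. if v \<in> S then 1 else 0)"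
    by (rule sum.cong) (auto simp: conf_apply)
  also have "\<dots> = int (card (V \<inter> S))" by (simp add: sum.If_cases)
  also have "V \<inter> S = S" using assms by (auto simp: indep_def)
  finally show ?thesis by (simp add: hamiltonian_def)
qed

lemma finite_X: "finite X"
proof (rule finite_subset)
  show "X \<subseteq> V \<rightarrow>\<^sub>E {0, 1}" by (auto simp: hc_configs_def)
  show "finite (V \<rightarrow>\<^sub>E {0, 1 :: int})" by (intro finite_PiE) auto
qed

lemma Q_insert:
  assumes "indep (insert v S)" "v \<notin> S"
  shows "Q (conf S) (conf (insert v S)) > 0" "Q (conf (insert v S)) (conf S) > 0"
proof -
  have v: "v \<in> V" using assms by (auto simp: indep_def)
  have d: "{u \<in> V. conf S u \<noteq> conf (insert v S) u} = {v}" "{u \<in> V. conf (insert v S) u \<noteq> conf S u} = {v}"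
    using v assms(2) by (auto simp: conf_apply split: if_splits)
  then have ne: "conf S \<noteq> conf (insert v S)" by auto
  have "card V > 0" using v by (auto simp: card_gt_0_iff)
  then show "Q (conf S) (conf (insert v S)) > 0" "Q (conf (insert v S)) (conf S) > 0"
    using ne d by (auto simp: hc_Q_def differ_at_one_def)
qed

lemma path_of_reach:
  assumes S: "indep S" "h \<le> int (card S)" and reach: "reach h S T"
  shows "\<exists>\<omega>. is_path X Q (conf S) \<omega> (conf T) \<and> path_height H \<omega> \<le> - h"
proof -
  have "(move h)\<^sup>*\<^sup>* S T" using reach by (simp add: reach_def)
  then have "\<exists>\<omega>. is_path X Q (conf S) \<omega> (conf T) \<and> (\<forall>\<eta>\<in>set \<omega>. H \<eta> \<le> - h)"
  proof (induction rule: rtranclp_induct)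
    case base
    have "is_path X Q (conf S) [conf S] (conf S)" using conf_in_X[OF S(1)] by (simp add: is_path_def)
    then show ?case using H_conf[OF S(1)] S(2) by (intro exI[of _ "[conf S]"]) simp
  next
    case (step T U)
    then obtain \<omega> where \<omega>: "is_path X Q (conf S) \<omega> (conf T)" "\<forall>\<eta>\<in>set \<omega>. H \<eta> \<le> - h" by blast
    have U: "indep T" "indep U" "h \<le> int (card U)" using step.hyps(2) by (auto simp: move_def)
    obtain v where "v \<notin> T \<and> U = insert v T \<or> v \<notin> U \<and> T = insert v U"
      using step.hyps(2) unfolding move_def by blast
    then have Q: "Q (conf T) (conf U) > 0" using Q_insert U by blast
    have "is_path X Q (conf S) (\<omega> @ [conf U]) (conf U)"
      unfolding is_path_def
    proof (intro conjI allI impI)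
      show "set (\<omega> @ [conf U]) \<subseteq> X" using \<omega> conf_in_X[OF U(2)] by (auto simp: is_path_def)
      show "hd (\<omega> @ [conf U]) = conf S" using \<omega> by (auto simp: is_path_def)
      fix i assume i: "Suc i < length (\<omega> @ [conf U])"
      show "Q ((\<omega> @ [conf U]) ! i) ((\<omega> @ [conf U]) ! Suc i) > 0"
      proof (cases "Suc i < length \<omega>")
        case True
        then show ?thesis using \<omega>(1) by (auto simp: is_path_def nth_append)
      next
        case False
        then have last: "Suc i = length \<omega>" using i by simp
        then have "i = length \<omega> - 1" by simp
        then have "\<omega> ! i = conf T" using \<omega>(1) last_conv_nth[of \<omega>] by (auto simp: is_path_def)
        then show ?thesis using Q last by (simp add: nth_append)
      qed
    qed auto
    then show ?case using \<omega>(2) H_conf[OF U(2)] U(3) by (intro exI[of _ "\<omega> @ [conf U]"]) auto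
  qed
  then obtain \<omega> where "is_path X Q (conf S) \<omega> (conf T)" "\<forall>\<eta>\<in>set \<omega>. H \<eta> \<le> - h" by blast
  moreover from this have "path_height H \<omega> \<le> - h" by (auto simp: path_height_def is_path_def)
  ultimately show ?thesis by blast
qed

lemma move_of_Q:
  assumes "\<sigma> \<in> X" "\<tau> \<in> X" "\<sigma> \<noteq> \<tau>" "Q \<sigma> \<tau> > 0" "H \<sigma> \<le> - h" "H \<tau> \<le> - h"
  shows "move h (supp \<sigma>) (supp \<tau>)"
proof -
  have "card {v \<in> V. \<sigma> v \<noteq> \<tau> v} = 1"
    using assms by (auto simp: hc_Q_def differ_at_one_def split: if_splits)
  then obtain v where d: "{v \<in> V. \<sigma> v \<noteq> \<tau> v} = {v}" by (metis card_1_singletonE)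
  then have v: "v \<in> V" "\<sigma> v \<noteq> \<tau> v" by auto
  have other: "u \<in> supp \<sigma> \<longleftrightarrow> u \<in> supp \<tau>" if "u \<noteq> v" for u
  proof -
    have "u \<in> V \<Longrightarrow> \<sigma> u = \<tau> u" using d that by blast
    then show ?thesis unfolding supp_def by auto
  qed
  have "v \<notin> supp \<sigma> \<and> supp \<tau> = insert v (supp \<sigma>) \<or> v \<notin> supp \<tau> \<and> supp \<sigma> = insert v (supp \<tau>)"
  proof (cases "\<sigma> v = 0")
    case True
    then have v': "v \<notin> supp \<sigma>" "v \<in> supp \<tau>"
      using v X_values[OF assms(2) v(1)] by (auto simp: supp_def)
    then have "u \<in> supp \<tau> \<longleftrightarrow> u \<in> insert v (supp \<sigma>)" for u using other[of u] by (cases "u = v") simp_all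
    then have "supp \<tau> = insert v (supp \<sigma>)" by (rule set_eqI)
    with v' show ?thesis by blast
  next
    case False
    then have v': "v \<in> supp \<sigma>" "v \<notin> supp \<tau>"
      using v X_values[OF assms(1) v(1)] by (auto simp: supp_def)
    then have "u \<in> supp \<sigma> \<longleftrightarrow> u \<in> insert v (supp \<tau>)" for u using other[of u] by (cases "u = v") simp_all
    then have "supp \<sigma> = insert v (supp \<tau>)" by (rule set_eqI)
    with v' show ?thesis by blast
  qed
  moreover have "indep (supp \<sigma>)" "indep (supp \<tau>)" using assms supp_indep by auto
  moreover have "h \<le> int (card (supp \<sigma>))" "h \<le> int (card (supp \<tau>))"
    using assms(5,6) H_conf[OF supp_indep[OF assms(1)]] H_conf[OF supp_indep[OF assms(2)]]
    by (simp_all add: conf_supp[OF assms(1)] conf_supp[OF assms(2)])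
  ultimately show ?thesis unfolding move_def by blast
qed

text \<open>
  A path may stay at a configuration, as the diagonal of \<open>Q\<close> can be positive; such
  steps are skipped.
\<close>

lemma reach_of_path:
  assumes path: "is_path X Q \<sigma> \<omega> \<tau>" and height: "path_height H \<omega> \<le> - h"
  shows "reach h (supp \<sigma>) (supp \<tau>)"
proof -
  have \<omega>: "\<omega> \<noteq> []" "set \<omega> \<subseteq> X" "\<sigma> = \<omega> ! 0" "\<tau> = \<omega> ! (length \<omega> - 1)"
    "\<And>i. Suc i < length \<omega> \<Longrightarrow> Q (\<omega> ! i) (\<omega> ! Suc i) > 0"
    using path by (auto simp: is_path_def hd_conv_nth last_conv_nth)
  have low: "H \<eta> \<le> - h" if "\<eta> \<in> set \<omega>" for \<eta>
  proof -
    have "H \<eta> \<le> Max (H ` set \<omega>)" using that by (intro Max_ge) auto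
    then show ?thesis using height unfolding path_height_def by linarith
  qed
  have "reach h (supp \<sigma>) (supp (\<omega> ! i))" if "i < length \<omega>" for i
    using that
  proof (induction i)
    case 0
    then show ?case by (simp add: \<omega>(3))
  next
    case (Suc i)
    have mem: "\<omega> ! i \<in> set \<omega>" "\<omega> ! Suc i \<in> set \<omega>" using Suc.prems by simp_all
    have "reach h (supp (\<omega> ! i)) (supp (\<omega> ! Suc i))"
    proof (cases "\<omega> ! i = \<omega> ! Suc i")
      case False
      then have "move h (supp (\<omega> ! i)) (supp (\<omega> ! Suc i))"
        using mem low \<omega>(2,5) Suc.prems by (intro move_of_Q) auto
      then show ?thesis by (simp add: reach_def)
    qed simp
    then show ?case using Suc reach_trans by (meson Suc_lessD)
  qed
  then show ?thesis using \<omega>(1,4) by simp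
qed

text \<open>
  There are infinitely many paths, and \<open>Min\<close> is meaningful only for finite sets: the
  heights are energies of configurations.
\<close>

lemma finite_heights: "finite {path_height H \<omega> |\<omega>. is_path X Q \<sigma> \<omega> \<tau>}"
proof (rule finite_subset[OF _ finite_imageI[OF finite_X, of H]])
  have "path_height H \<omega> \<in> H ` X" if "is_path X Q \<sigma> \<omega> \<tau>" for \<omega>
  proof -
    have "\<omega> \<noteq> []" "set \<omega> \<subseteq> X" using that by (auto simp: is_path_def)
    then have "Max (H ` set \<omega>) \<in> H ` set \<omega>" by (intro Max_in) auto
    then show ?thesis using \<open>set \<omega> \<subseteq> X\<close> by (auto simp: path_height_def)
  qed
  then show "{path_height H \<omega> |\<omega>. is_path X Q \<sigma> \<omega> \<tau>} \<subseteq> H ` X" by blast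
qed

lemma Phi_le:
  assumes "indep S" "h \<le> int (card S)" "reach h S T"
  shows "Phi K L (conf S) (conf T) \<le> - h"
proof -
  obtain \<omega> where "is_path X Q (conf S) \<omega> (conf T)" "path_height H \<omega> \<le> - h"
    using path_of_reach[OF assms] by blast
  then show ?thesis unfolding comm_height_def
    using Min_le[OF finite_heights, of "path_height H \<omega>" "conf S" "conf T"] by fastforce
qed

lemma Phi_le_D:
  assumes S: "indep S" "indep T" "h' \<le> int (card S)" "reach h' S T"
    and "Phi K L (conf S) (conf T) \<le> - h"
  shows "reach h S T"
proof -
  have "{path_height H \<omega> |\<omega>. is_path X Q (conf S) \<omega> (conf T)} \<noteq> {}"
    using path_of_reach[OF S(1,3,4)] by blast
  from Min_in[OF finite_heights this] obtain \<omega>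
    where "is_path X Q (conf S) \<omega> (conf T)" "path_height H \<omega> = Phi K L (conf S) (conf T)"
    unfolding comm_height_def by force
  then show ?thesis using reach_of_path[of "conf S" \<omega> "conf T" h] assms(5) S by (simp add: supp_conf)
qed

lemma Phi_between_classes:
  assumes "r \<in> {0, 1, 2}" "s \<in> {0, 1, 2}" "r \<noteq> s"
  shows "Phi K L (conf (cls r)) (conf (cls s)) - H (conf (cls r)) = int (min K (2 * L)) + 1"
proof -
  let ?m = "int (min K (2 * L))" and ?P = "Phi K L (conf (cls r)) (conf (cls s))"
  let ?h = "2 * int K * int L - ?m"
  have card: "int (card (cls r)) = 2 * int K * int L" using assms(1) by (rule card_cls)
  have reach: "reach (?h - 1) (cls r) (cls s)" using reach_between_classes[OF assms(1,2)] .
  have le: "?h - 1 \<le> int (card (cls r))" by (simp add: card)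
  have "?P \<le> - (?h - 1)" by (rule Phi_le[OF cls_indep le reach])
  moreover have "\<not> ?P \<le> - ?h"
    using Phi_le_D[OF cls_indep cls_indep le reach] no_reach_between_classes[OF _ assms(1,2)] assms(3) by blast
  ultimately have "?P = - ?h + 1" by linarith
  then show ?thesis by (simp add: H_conf[OF cls_indep] card)
qed

lemma stable_configs_eq: "stable_configs X H = (\<lambda>r. conf (cls r)) ` {0, 1, 2}"
proof (intro equalityI subsetI)
  fix \<sigma> assume "\<sigma> \<in> stable_configs X H"
  then have \<sigma>: "\<sigma> \<in> X" "\<And>\<tau>. \<tau> \<in> X \<Longrightarrow> H \<sigma> \<le> H \<tau>" by (auto simp: stable_configs_def)
  have ind: "indep (supp \<sigma>)" by (rule supp_indep[OF \<sigma>(1)])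
  have "H \<sigma> \<le> H (conf (cls 0))" by (rule \<sigma>(2)[OF conf_in_X[OF cls_indep]])
  then have "int (card (supp \<sigma>)) \<ge> 2 * int K * int L"
    using H_conf[OF ind] H_conf[OF cls_indep, of 0] card_cls[of 0] by (simp add: conf_supp \<sigma>)
  then have "int (card (supp \<sigma>)) = 2 * int K * int L" using card_le_max[OF ind] by simp
  then obtain r where "r \<in> {0, 1, 2}" "supp \<sigma> = cls r" using max_card_imp_cls[OF ind] by blast
  then show "\<sigma> \<in> (\<lambda>r. conf (cls r)) ` {0, 1, 2}" using conf_supp[OF \<sigma>(1)] by (intro image_eqI[of _ _ r]) simp_all
next
  fix \<sigma> assume "\<sigma> \<in> (\<lambda>r. conf (cls r)) ` {0, 1, 2}"
  then obtain r where r: "r \<in> {0, 1, 2}" "\<sigma> = conf (cls r)" by blast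
  have "H \<sigma> \<le> H \<tau>" if "\<tau> \<in> X" for \<tau>
    using card_le_max[OF supp_indep[OF that]] H_conf[OF supp_indep[OF that]] H_conf[OF cls_indep, of r]
      card_cls[OF r(1)] by (simp add: conf_supp that r(2))
  then show "\<sigma> \<in> stable_configs X H" using conf_in_X[OF cls_indep] r(2) by (auto simp: stable_configs_def)
qed

lemma Phi_to_stable:
  assumes "\<sigma> \<in> X"
  shows "Phi_sets K L {\<sigma>} ((\<lambda>r. conf (cls r)) ` {0, 1, 2}) - H \<sigma> \<le> int (min K (2 * L))"
proof -
  have ind: "indep (supp \<sigma>)" by (rule supp_indep[OF assms])
  let ?h = "int (card (supp \<sigma>)) - int (min K (2 * L))"
  obtain r where r: "r \<in> {0, 1, 2}" "reach ?h (supp \<sigma>) (cls r)" using reach_stable[OF ind] by blast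
  have "Phi K L (conf (supp \<sigma>)) (conf (cls r)) \<le> - ?h" by (rule Phi_le[OF ind _ r(2)]) simp
  then have "Phi K L \<sigma> (conf (cls r)) \<le> H \<sigma> + int (min K (2 * L))"
    using H_conf[OF ind] by (simp add: conf_supp assms)
  moreover have "Phi_sets K L {\<sigma>} ((\<lambda>r. conf (cls r)) ` {0, 1, 2}) \<le> Phi K L \<sigma> (conf (cls r))"
    unfolding comm_height_sets_def
  proof (rule Min_le)
    have "{Phi K L \<sigma>' \<tau> |\<sigma>' \<tau>. \<sigma>' \<in> {\<sigma>} \<and> \<tau> \<in> (\<lambda>r. conf (cls r)) ` {0, 1, 2}}
        = Phi K L \<sigma> ` (\<lambda>r. conf (cls r)) ` {0, 1, 2}" by blast
    then show "finite {Phi K L \<sigma>' \<tau> |\<sigma>' \<tau>. \<sigma>' \<in> {\<sigma>} \<and> \<tau> \<in> (\<lambda>r. conf (cls r)) ` {0, 1, 2}}" by simp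
  qed (use r(1) in blast)
  ultimately show ?thesis by linarith
qed

end

theorem theorem3p1:
  fixes K L :: nat
  assumes "K \<ge> 2" and "L \<ge> 1"
  shows "stable_configs (hc_configs K L) (hamiltonian K L) = {conf_a K L, conf_b K L, conf_c K L}
    \<and> (Phi K L (conf_a K L) (conf_b K L) - hamiltonian K L (conf_a K L) = int (min K (2 * L)) + 1
       \<and> Phi K L (conf_a K L) (conf_c K L) - hamiltonian K L (conf_a K L) = int (min K (2 * L)) + 1
       \<and> Phi K L (conf_b K L) (conf_c K L) - hamiltonian K L (conf_b K L) = int (min K (2 * L)) + 1)
    \<and> (\<forall>\<sigma> \<in> hc_configs K L - {conf_a K L, conf_b K L, conf_c K L}.
         Phi_sets K L {\<sigma>} {conf_a K L, conf_b K L, conf_c K L} - hamiltonian K L \<sigma>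
           \<le> int (min K (2 * L)))"
proof -
  interpret torus K L using assms by unfold_locales
  have abc: "{conf_a K L, conf_b K L, conf_c K L} = (\<lambda>r. conf_of K L (sites_class K L r)) ` {0, 1, 2}"
    by (simp add: conf_a_def conf_b_def conf_c_def)
  show ?thesis
    unfolding abc stable_configs_eq
    using Phi_between_classes[of 0 1] Phi_between_classes[of 0 2] Phi_between_classes[of 1 2] Phi_to_stable
    by (simp add: conf_a_def conf_b_def conf_c_def)
qed

end
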